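(* Let $A$ be a finite set of cardinality $N\ge 2$. Let $(\ell_n)_{n\le 0}$ be defined by $\ell_0=1$ and $\ell_{n-1}=4^{\sqrt{\ell_n}}$ for every $n\le 0$ (so that $\ell_{n-1}/\ell_n$ is an integer $\ge 2$ for every $n \le 0$), and let $\mathcal{F}^{X,V}=(\mathcal{F}^{X,V}_n)_{n\le 0}$ be the natural filtration of a split-word process $(X_n,V_n)_{n\le 0}$ with alphabet $A$ and lengths $(\ell_n)_{n\le 0}$. Then $(\mathcal{F}^{X,V}_n)_{n\le 0}$ is not of product type. Yet, for every strictly increasing map $\phi$ from the set of nonpositive integers to itself such that $\phi(n)-n\to-\infty$ as $n\to-\infty$, the filtration $(\mathcal{F}^{X,V}_{\phi(n)})_{n\le 0}$ is of product type.
   Context: All sequences and filtrations are indexed by the nonpositive integers. Equalities of $\sigma$-fields are understood modulo null sets. Split-word process with alphabet $A$ and lengths $(\ell_n)_{n\le 0}$, where $\ell_0=1$ and $r_n=\ell_{n-1}/\ell_n$ is an integer $\ge 2$ for every $n\le 0$: a process $(X_n,V_n)_{n\le 0}$ such that for every $n\le 0$: (1) $X_n$ is uniformly distributed on $A^{\ell_n}$; (2) $V_n$ is uniformly distributed on $\{1,\dots,r_n\}$ and independent of $\mathcal{F}^{X,V}_{n-1}=\sigma(X_m,V_m\,;\,m\le n-1)$; (3) if the word $X_{n-1}$ (of length $\ell_{n-1}=r_n\ell_n$) is cut into $r_n$ consecutive subwords of length $\ell_n$, then $X_n$ is the $V_n$-th of these subwords. Its natural filtration is given by $\mathcal{F}^{X,V}_n=\sigma(X_m,V_m\,;\,m\le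 n)$. A filtration $(\mathcal{G}_n)_{n\le 0}$ is of product type if there is a process $(W_n)_{n\le 0}$ of independent random variables with $\mathcal{G}_n=\sigma(W_m\,;\,m\le n)$ for all $n\le 0$. *)

theory Defs
  imports "HOL-Probability.Probability"
begin

text \<open>Processes and filtrations are indexed by the integers \<open>n \<le> 0\<close>; their values at positive
  integers play no role. A filtration is a family of \<open>\<sigma>\<close>-fields, given as sets of events.\<close>

definition sigma_field_of ::
    "'w measure \<Rightarrow> (int \<Rightarrow> 'c measure) \<Rightarrow> (int \<Rightarrow> 'w \<Rightarrow> 'c) \<Rightarrow> int set \<Rightarrow> 'w set set" where
  "sigma_field_of M S Y I =
     sigma_sets (space M) (\<Union>m\<in>I. {Y m -` B \<inter> space M | B. B \<in> sets (S m)})"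

definition natural_filtration ::
    "'w measure \<Rightarrow> (int \<Rightarrow> 'c measure) \<Rightarrow> (int \<Rightarrow> 'w \<Rightarrow> 'c) \<Rightarrow> int \<Rightarrow> 'w set set" where
  "natural_filtration M S Y n = sigma_field_of M S Y {..n}"

definition eq_mod_null :: "'w measure \<Rightarrow> 'w set set \<Rightarrow> 'w set set \<Rightarrow> bool" where
  "eq_mod_null M \<G> \<H> \<longleftrightarrow>
     sigma_sets (space M) (\<G> \<union> null_sets M) = sigma_sets (space M) (\<H> \<union> null_sets M)"

text \<open>The variables \<open>W n\<close> may take values in arbitrary measurable spaces \<open>S n\<close>. That these spaces are
  carried by the type of the sample points is no restriction: a variable \<open>W n\<close> with values in
  any other space can be replaced by the identity map from \<open>\<Omega>\<close> to \<open>(\<Omega>, \<sigma>(W n))\<close>; see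
  \<open>product_typeI\<close> below.\<close>

definition product_type :: "'w measure \<Rightarrow> (int \<Rightarrow> 'w set set) \<Rightarrow> bool" where
  "product_type M \<G> \<longleftrightarrow>
     (\<exists>(S :: int \<Rightarrow> 'w measure) (W :: int \<Rightarrow> 'w \<Rightarrow> 'w).
        prob_space.indep_vars M S W {..0} \<and>
        (\<forall>n\<le>0. eq_mod_null M (\<G> n) (natural_filtration M S W n)))"

lemma (in prob_space) product_typeI:
  fixes S :: "int \<Rightarrow> 'c measure" and W :: "int \<Rightarrow> 'a \<Rightarrow> 'c"
  assumes indep: "indep_vars S W {..0}"
    and gen: "\<And>n. n \<le> 0 \<Longrightarrow> eq_mod_null M (\<G> n) (natural_filtration M S W n)"
  shows "product_type M \<G>"
proof -
  define S' where "S' n = vimage_algebra (space M) (W n) (S n)" for n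
  define W' where "W' n = (\<lambda>\<omega>::'a. \<omega>)" for n :: int
  have meas: "W n \<in> measurable M (S n)" if "n \<le> 0" for n
    using indep that by (auto simp: indep_vars_def2)
  have sets_S': "sets (S' n) = {W n -` B \<inter> space M | B. B \<in> sets (S n)}" if "n \<le> 0" for n
    unfolding S'_def
    by (rule sets_vimage_algebra2) (rule Pi_I, rule measurable_space[OF meas[OF that]])
  have same: "{W' n -` B \<inter> space M | B. B \<in> sets (S' n)} = {W n -` B \<inter> space M | B. B \<in> sets (S n)}"
    if "n \<le> 0" for n
  proof -
    have id: "W' n -` B \<inter> space M = B" if "B \<in> sets (S' n)" for B
      using sets.sets_into_space[OF that] unfolding W'_def S'_def by auto
    have "{W' n -` B \<inter> space M | B. B \<in> sets (S' n)} = (\<lambda>B. W' n -` B \<inter> space M) ` sets (S' n)"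
      by (rule Setcompr_eq_image)
    also have "\<dots> = sets (S' n)"
      using id by simp
    finally show ?thesis
      unfolding sets_S'[OF that] .
  qed
  have "W' n \<in> measurable M (S' n)" if "n \<le> 0" for n
    unfolding W'_def S'_def
    by (rule measurable_vimage_algebra2) (simp_all add: meas[OF that])
  moreover have "indep_sets (\<lambda>n. {W' n -` B \<inter> space M | B. B \<in> sets (S' n)}) {..0} \<longleftrightarrow>
      indep_sets (\<lambda>n. {W n -` B \<inter> space M | B. B \<in> sets (S n)}) {..0}"
    by (rule indep_sets_cong[OF refl], rule same, simp)
  ultimately have "indep_vars S' W' {..0}"
    using indep unfolding indep_vars_def2 by blast
  moreover have "natural_filtration M S' W' n = natural_filtration M S W n" if "n \<le> 0" for n
    unfolding natural_filtration_def sigma_field_of_def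
    by (rule arg_cong2[where f = sigma_sets, OF refl], rule SUP_cong[OF refl], rule same)
      (use that in simp)
  ultimately show ?thesis
    using gen unfolding product_type_def by (intro exI[of _ S'] exI[of _ W']) simp
qed

definition split_ratio :: "(int \<Rightarrow> nat) \<Rightarrow> int \<Rightarrow> nat" where
  "split_ratio len n = len (n - 1) div len n"

definition words :: "'a set \<Rightarrow> nat \<Rightarrow> 'a list set" where
  "words A l = {xs. set xs \<subseteq> A \<and> length xs = l}"

text \<open>The \<open>v\<close>-th block of length \<open>l\<close> of a word, where blocks are numbered from 1.\<close>

definition subword :: "nat \<Rightarrow> nat \<Rightarrow> 'a list \<Rightarrow> 'a list" where
  "subword l v xs = take l (drop ((v - 1) * l) xs)"

definition split_word_space :: "'a set \<Rightarrow> (int \<Rightarrow> nat) \<Rightarrow> int \<Rightarrow> ('a list \<times> nat) measure" where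
  "split_word_space A len n = count_space (words A (len n)) \<Otimes>\<^sub>M count_space {1..split_ratio len n}"

definition split_word_filtration ::
    "'w measure \<Rightarrow> 'a set \<Rightarrow> (int \<Rightarrow> nat) \<Rightarrow> (int \<Rightarrow> 'w \<Rightarrow> 'a list) \<Rightarrow> (int \<Rightarrow> 'w \<Rightarrow> nat) \<Rightarrow> int \<Rightarrow> 'w set set"
  where
  "split_word_filtration M A len X V =
     natural_filtration M (split_word_space A len) (\<lambda>m \<omega>. (X m \<omega>, V m \<omega>))"

locale split_word_process = prob_space M
  for M :: "'w measure" and A :: "'a set" and len :: "int \<Rightarrow> nat"
    and X :: "int \<Rightarrow> 'w \<Rightarrow> 'a list" and V :: "int \<Rightarrow> 'w \<Rightarrow> nat" +
  assumes length_0: "len 0 = 1"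
    and length_dvd: "\<And>n. n \<le> 0 \<Longrightarrow> len n dvd len (n - 1)"
    and ratio_ge_2: "\<And>n. n \<le> 0 \<Longrightarrow> 2 \<le> split_ratio len n"
    and X_measurable: "\<And>n. n \<le> 0 \<Longrightarrow> X n \<in> measurable M (count_space (words A (len n)))"
    and X_uniform: "\<And>n. n \<le> 0 \<Longrightarrow>
      distr M (count_space (words A (len n))) (X n) = uniform_count_measure (words A (len n))"
    and V_measurable: "\<And>n. n \<le> 0 \<Longrightarrow> V n \<in> measurable M (count_space {1..split_ratio len n})"
    and V_uniform: "\<And>n. n \<le> 0 \<Longrightarrow>
      distr M (count_space {1..split_ratio len n}) (V n) = uniform_count_measure {1..split_ratio len n}"
    and V_indep: "\<And>n. n \<le> 0 \<Longrightarrow>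
      indep_set (sigma_field_of M (\<lambda>m. count_space {1..split_ratio len m}) V {n})
        (split_word_filtration M A len X V (n - 1))"
    and X_split: "\<And>n. n \<le> 0 \<Longrightarrow> AE \<omega> in M. X n \<omega> = subword (len n) (V n \<omega>) (X (n - 1) \<omega>)"

text \<open>The lengths given by the recursion \<open>len (n - 1) = 4 powr sqrt (len n)\<close> automatically satisfy the
  divisibility conditions of \<open>split_word_process\<close>.\<close>

lemma power_recursion_ratio:
  fixes len :: "int \<Rightarrow> nat"
  assumes l0: "len 0 = 1"
    and rec: "\<And>n. n \<le> 0 \<Longrightarrow> real (len (n - 1)) = 4 powr sqrt (real (len n))"
    and n: "n \<le> 0"
  shows "len n dvd len (n - 1)" and "2 \<le> split_ratio len n"
proof -
  have step: "len (m - 1) = 4 ^ (2 ^ j)" if "m \<le> 0" "len m = 4 ^ j" for m j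
  proof -
    have "(4::real) ^ j = (2\<^sup>2) ^ j" by simp
    also have "\<dots> = (2 ^ j)\<^sup>2" by (simp only: power_mult[symmetric] mult.commute)
    finally have "sqrt (real (len m)) = real (2 ^ j)"
      unfolding that(2) by simp
    then have "real (len (m - 1)) = 4 powr real (2 ^ j)"
      using rec[OF that(1)] by simp
    then have "real (len (m - 1)) = real (4 ^ (2 ^ j))"
      by (subst (asm) powr_realpow) simp_all
    then show ?thesis
      by (rule of_nat_eq_iff[THEN iffD1])
  qed
  have "\<exists>j. len (- int k) = 4 ^ j" for k
  proof (induction k)
    case 0
    show ?case using l0 by (intro exI[of _ 0]) simp
  next
    case (Suc k)
    then obtain j where "len (- int k) = 4 ^ j" by blast
    then have "len (- int k - 1) = 4 ^ (2 ^ j)" by (intro step) auto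
    moreover have "- int (Suc k) = - int k - 1" by simp
    ultimately show ?case by metis
  qed
  from this[of "nat (- n)"] obtain j where j: "len n = 4 ^ j" using n by auto
  have pos: "j < 2 ^ j" by (rule less_exp)
  have "len (n - 1) = 4 ^ (j + (2 ^ j - j))"
    using step[OF n j] pos by simp
  then have l: "len (n - 1) = 4 ^ j * 4 ^ (2 ^ j - j)"
    by (simp only: power_add)
  show "len n dvd len (n - 1)" unfolding l j by simp
  have "split_ratio len n = 4 ^ (2 ^ j - j)" unfolding split_ratio_def l j by simp
  moreover have "(4::nat) ^ 1 \<le> 4 ^ (2 ^ j - j)" using pos
    by (intro power_increasing) linarith+
  ultimately show "2 \<le> split_ratio len n" by simp
qed

end

theory Submission
  imports Defs
begin

text \<open>
  Write \<open>K\<close> for the number of words of length \<open>len n\<close> and \<open>R\<close> for the number of blocks of that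
  length in a word at an earlier time. The statement reflects the two sides of one threshold: the
  filtration is of product type or not according to whether the sum of
  \<open>log (split_ratio len n) / len n\<close> diverges or converges. For the given lengths the terms are of
  order \<open>1 / sqrt (len n)\<close> and their sum converges; skipping a single level replaces such a term by
  one of order \<open>2 ^ sqrt (len n) / len n\<close>, which is huge.

  \<^bold>\<open>Extracted filtrations.\<close> Between the times \<open>\<phi> (n - 1)\<close> and \<open>\<phi> n\<close> the process chooses a uniform
  block number \<open>U n\<close>, independently of the past. Replacing \<open>U n\<close> by \<open>W n = \<pi> (U n)\<close>, where the
  permutation \<open>\<pi>\<close> may depend on the word at time \<open>\<phi> (n - 1)\<close>, yields again a uniform innovation that
  carries the same information given the past. If \<open>R\<close> is much larger than \<open>K\<close>, all words occur
  almost equally often among the blocks of a random word (a variance estimate), so \<open>\<pi>\<close> can be chosen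
  such that \<open>W n\<close> alone predicts the word at time \<open>\<phi> n\<close> with probability close to 1 (lemma
  \<open>exists_good_relabelling\<close>). Every jump of \<open>\<phi>\<close> of size at least 2 makes \<open>R\<close> this large. As there are
  infinitely many of them, and as a correct prediction can be propagated forwards with the later
  innovations, each word is, up to arbitrarily small errors, a function of the \<open>W\<close>, which
  therefore generate the filtration (\<open>product_type_if_ratios_large\<close>).

  \<^bold>\<open>The full filtration.\<close> Suppose that independent variables \<open>W k\<close> generate the filtration. The word
  at time \<open>-3\<close> is then predicted, up to a small error, by finitely many events taken from the
  \<open>\<sigma>\<close>-fields of the \<open>W k\<close>. The pattern of the events at time \<open>k\<close> is independent of the past and, given
  the past, is a function of \<open>V k\<close>; so each of its values has probability at least
  \<open>1 / split_ratio len k\<close> (\<open>innovation_atom\<close>), and there are at most \<open>split_ratio len k\<close> of them. A predictor is thus a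
  labelling by words of a tree that has the same branching numbers as the word process. The best
  possible performance of a labelling against a word is measured by \<open>cost\<close>. Bounding an exponential
  moment of the cost amounts to counting the labelled trees that can fit a word: each level
  contributes a factor \<open>split_ratio len k\<close> per block, that is, \<open>log (split_ratio len k) / len k\<close> per letter. The sum of
  these is too small to compete with \<open>log (card A)\<close>, so a random word cannot be predicted with
  probability above \<open>1 / 2\<close> (\<open>cost_mean\<close>, \<open>prediction_error\<close>).
\<close>

section \<open>Words cut into blocks\<close>
lemma finite_words: "finite A \<Longrightarrow> finite (words A l)"
  unfolding words_def by (rule finite_lists_length_eq)

lemma card_words: "finite A \<Longrightarrow> card (words A l) = card A ^ l"
  unfolding words_def by (rule card_lists_length_eq)

lemma length_words: "x \<in> words A l \<Longrightarrow> length x = l"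
  by (simp add: words_def)

lemma words_0: "words A 0 = {[]}"
  by (auto simp: words_def)

lemma words_nonempty: "A \<noteq> {} \<Longrightarrow> words A l \<noteq> {}"
proof -
  assume "A \<noteq> {}"
  then obtain a where "a \<in> A" by blast
  then have "replicate l a \<in> words A l" by (auto simp: words_def)
  then show ?thesis by blast
qed

text \<open>The blocks of \<open>subword\<close> are renumbered from 0, so that nested block numbers combine by
  \<open>u * r + v\<close>.\<close>
definition block :: "nat \<Rightarrow> nat \<Rightarrow> 'a list \<Rightarrow> 'a list" where
  "block l u xs = take l (drop (u * l) xs)"

lemma subword_eq_block: "subword l v xs = block l (v - 1) xs"
  by (simp add: subword_def block_def)

lemma block_in_words:
  assumes "xs \<in> words A (r * l)" and "u < r"
  shows "block l u xs \<in> words A l"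
proof -
  have "u * l + l \<le> r * l"
    using mult_le_mono1[of "Suc u" r l] assms(2) by simp
  then show ?thesis
    using assms(1) by (auto simp: words_def block_def dest!: in_set_takeD in_set_dropD)
qed

lemma block_block:
  assumes "v < r"
  shows "block l v (block (r * l) u xs) = block l (u * r + v) xs"
proof -
  have "v * l + l \<le> r * l"
    using mult_le_mono1[of "Suc v" r l] assms by simp
  then have "min l (r * l - v * l) = l" by simp
  then show ?thesis
    unfolding block_def by (simp add: drop_take algebra_simps)
qed

lemma sum_words_append:
  fixes g :: "'a list \<Rightarrow> real"
  shows "(\<Sum>x\<in>words A (l + m). g x) = (\<Sum>y\<in>words A l. \<Sum>z\<in>words A m. g (y @ z))"
proof -
  have "bij_betw (\<lambda>(y, z). y @ z) (words A l \<times> words A m) (words A (l + m))"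
    by (rule bij_betw_byWitness[where f' = "\<lambda>x. (take l x, drop l x)"])
      (auto simp: words_def dest!: in_set_takeD in_set_dropD)
  then show ?thesis
    by (simp add: sum.reindex_bij_betw[symmetric] sum.cartesian_product case_prod_beta)
qed

lemma block_append:
  assumes "length y = l"
  shows "block l 0 (y @ z) = y" and "block l (Suc u) (y @ z) = block l u z"
  using assms by (simp_all add: block_def)

text \<open>The blocks of a uniform word are independent and uniform. This lemma (expectation of a product)
  and the two that follow (mean and variance of a sum) state the consequences that are used, as
  sums over all words.\<close>
lemma sum_words_prod_blocks:
  fixes F :: "'a list \<Rightarrow> real"
  shows "(\<Sum>x\<in>words A (r * l). \<Prod>u<r. F (block l u x)) = (\<Sum>y\<in>words A l. F y) ^ r"
proof (induction r)
  case 0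
  then show ?case by (simp add: words_0)
next
  case (Suc r)
  have "(\<Sum>x\<in>words A (Suc r * l). \<Prod>u<Suc r. F (block l u x)) =
      (\<Sum>y\<in>words A l. \<Sum>z\<in>words A (r * l). F y * (\<Prod>u<r. F (block l u z)))"
    by (simp add: sum_words_append prod.lessThan_Suc_shift block_append length_words
        del: prod.lessThan_Suc)
  also have "\<dots> = (\<Sum>y\<in>words A l. F y) * (\<Sum>y\<in>words A l. F y) ^ r"
    unfolding Suc.IH[symmetric] by (simp add: sum_product)
  finally show ?case by simp
qed

lemma sum_words_centred:
  fixes g :: "'a list \<Rightarrow> real"
  assumes "(\<Sum>y\<in>words A l. g y) = 0"
  shows "(\<Sum>x\<in>words A (r * l). \<Sum>u<r. g (block l u x)) = 0"
proof (induction r)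
  case 0
  then show ?case by simp
next
  case (Suc r)
  have "(\<Sum>x\<in>words A (Suc r * l). \<Sum>u<Suc r. g (block l u x)) =
      (\<Sum>y\<in>words A l. \<Sum>z\<in>words A (r * l). g y + (\<Sum>u<r. g (block l u z)))"
    by (simp add: sum_words_append sum.lessThan_Suc_shift block_append length_words
        del: sum.lessThan_Suc)
  also have "\<dots> = 0"
    by (simp add: sum.distrib Suc.IH sum_distrib_left[symmetric] assms)
  finally show ?case .
qed

lemma sum_words_variance:
  fixes g :: "'a list \<Rightarrow> real"
  assumes A: "finite A" and g0: "(\<Sum>y\<in>words A l. g y) = 0"
  shows "(\<Sum>x\<in>words A (r * l). (\<Sum>u<r. g (block l u x))\<^sup>2) * card (words A l) =
    real r * card (words A l) ^ r * (\<Sum>y\<in>words A l. (g y)\<^sup>2)"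
proof (induction r)
  case 0
  then show ?case by simp
next
  case (Suc r)
  define K where "K = real (card (words A l))"
  define S where "S z = (\<Sum>u<r. g (block l u z))" for z
  define \<sigma> where "\<sigma> = (\<Sum>y\<in>words A l. (g y)\<^sup>2)"
  have K: "real (card (words A (r * l))) = K ^ r"
    using A by (simp add: K_def card_words power_mult[symmetric] mult.commute)
  have "(\<Sum>x\<in>words A (Suc r * l). (\<Sum>u<Suc r. g (block l u x))\<^sup>2) =
      (\<Sum>y\<in>words A l. \<Sum>z\<in>words A (r * l). (g y + S z)\<^sup>2)"
    by (simp add: sum_words_append sum.lessThan_Suc_shift block_append length_words S_def
        del: sum.lessThan_Suc)
  also have "\<dots> = (\<Sum>y\<in>words A l. K ^ r * (g y)\<^sup>2 + (\<Sum>z\<in>words A (r * l). (S z)\<^sup>2)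
      + 2 * g y * (\<Sum>z\<in>words A (r * l). S z))"
    by (simp add: power2_sum sum.distrib K sum_distrib_left)
  also have "(\<Sum>z\<in>words A (r * l). S z) = 0"
    unfolding S_def by (rule sum_words_centred[OF g0])
  finally have "(\<Sum>x\<in>words A (Suc r * l). (\<Sum>u<Suc r. g (block l u x))\<^sup>2) =
      K ^ r * \<sigma> + K * (\<Sum>z\<in>words A (r * l). (S z)\<^sup>2)"
    by (simp add: sum.distrib \<sigma>_def sum_distrib_left K_def)
  moreover have "(\<Sum>z\<in>words A (r * l). (S z)\<^sup>2) * K = real r * K ^ r * \<sigma>"
    using Suc.IH by (simp add: S_def K_def \<sigma>_def)
  ultimately have "(\<Sum>x\<in>words A (Suc r * l). (\<Sum>u<Suc r. g (block l u x))\<^sup>2) * K =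
      K ^ r * \<sigma> * K + K * (real r * K ^ r * \<sigma>)"
    by (simp add: algebra_simps)
  then show ?case
    by (simp add: K_def[symmetric] \<sigma>_def[symmetric] algebra_simps)
qed

section \<open>Matching the blocks of a random word with a fixed labelling\<close>

text \<open>Two labellings \<open>x\<close> and \<open>f\<close> of \<open>{..<R}\<close> can be aligned as well as the numbers of occurrences of
  each label permit: match greedily inside each label and extend to a permutation.\<close>
lemma exists_matching_permutation:
  fixes x f :: "nat \<Rightarrow> 'b"
  assumes B: "finite B" and x: "\<And>u. u < R \<Longrightarrow> x u \<in> B" and f: "\<And>i. i < R \<Longrightarrow> f i \<in> B"
  shows "\<exists>\<pi>. bij_betw \<pi> {..<R} {..<R} \<and>
    card {u\<in>{..<R}. f (\<pi> u) \<noteq> x u} \<le>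
      (\<Sum>b\<in>B. card {u\<in>{..<R}. x u = b} - card {i\<in>{..<R}. f i = b})"
proof -
  define P where "P b = {u\<in>{..<R}. x u = b}" for b
  define Q where "Q b = {i\<in>{..<R}. f i = b}" for b
  have "\<forall>b. \<exists>S T g. S \<subseteq> P b \<and> T \<subseteq> Q b \<and> card S = min (card (P b)) (card (Q b)) \<and> bij_betw g S T"
  proof
    fix b
    obtain S where S: "S \<subseteq> P b" "card S = min (card (P b)) (card (Q b))" "finite S"
      using obtain_subset_with_card_n[OF min.cobounded1[of "card (P b)" "card (Q b)"]] by metis
    obtain T where T: "T \<subseteq> Q b" "card T = min (card (P b)) (card (Q b))" "finite T"
      using obtain_subset_with_card_n[OF min.cobounded2[of "card (P b)" "card (Q b)"]] by metis
    obtain g where "bij_betw g S T"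
      using finite_same_card_bij[OF S(3) T(3)] S(2) T(2) by auto
    then show "\<exists>S T g. S \<subseteq> P b \<and> T \<subseteq> Q b \<and> card S = min (card (P b)) (card (Q b)) \<and> bij_betw g S T"
      using S T by blast
  qed
  then obtain S T g where ST: "\<And>b. S b \<subseteq> P b" "\<And>b. T b \<subseteq> Q b"
      "\<And>b. card (S b) = min (card (P b)) (card (Q b))" "\<And>b. bij_betw (g b) (S b) (T b)"
    by metis
  define S' where "S' = (\<Union>b\<in>B. S b)"
  define T' where "T' = (\<Union>b\<in>B. T b)"
  have sub: "S' \<subseteq> {..<R}" "T' \<subseteq> {..<R}"
    using ST(1,2) by (auto simp: S'_def T'_def P_def Q_def)
  have xS: "x u = b" if "u \<in> S b" for u b using ST(1)[of b] that by (auto simp: P_def)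
  have fT: "f u = b" if "u \<in> T b" for u b using ST(2)[of b] that by (auto simp: Q_def)
  have gT: "g b u \<in> T b" if "u \<in> S b" for u b using ST(4)[of b] that by (auto simp: bij_betw_def)
  have g: "bij_betw (\<lambda>u. g (x u) u) S' T'"
    unfolding bij_betw_def
  proof
    show "inj_on (\<lambda>u. g (x u) u) S'"
    proof (rule inj_onI)
      fix u v assume "u \<in> S'" "v \<in> S'" and eq: "g (x u) u = g (x v) v"
      then obtain b c where b: "u \<in> S b" "v \<in> S c" by (auto simp: S'_def)
      have "f (g (x u) u) = b" "f (g (x v) v) = c"
        using b by (simp_all add: xS fT[OF gT])
      then have "b = c" using eq by simp
      then show "u = v"
        using b eq inj_onD[OF bij_betw_imp_inj_on[OF ST(4)[of b]], of u v] by (simp add: xS)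
    qed
    show "(\<lambda>u. g (x u) u) ` S' = T'"
    proof (safe)
      fix u assume "u \<in> S'"
      then show "g (x u) u \<in> T'" using xS gT by (fastforce simp: S'_def T'_def)
    next
      fix t assume "t \<in> T'"
      then obtain b where b: "b \<in> B" "t \<in> T b" by (auto simp: T'_def)
      then obtain u where "u \<in> S b" "t = g b u" using ST(4)[of b] by (auto simp: bij_betw_def)
      then show "t \<in> (\<lambda>u. g (x u) u) ` S'" using b xS by (force simp: S'_def)
    qed
  qed
  have fin: "finite S'" "finite T'" using sub finite_subset by blast+
  have "card ({..<R} - S') = card ({..<R} - T')"
    using bij_betw_same_card[OF g] sub fin by (simp add: card_Diff_subset)
  then obtain h where h: "bij_betw h ({..<R} - S') ({..<R} - T')"
    using finite_same_card_bij[of "{..<R} - S'" "{..<R} - T'"] by auto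
  define \<pi> where "\<pi> u = (if u \<in> S' then g (x u) u else h u)" for u
  have "bij_betw \<pi> (S' \<union> ({..<R} - S')) (T' \<union> ({..<R} - T'))"
    unfolding \<pi>_def by (rule bij_betw_disjoint_Un[OF g h]) auto
  then have \<pi>: "bij_betw \<pi> {..<R} {..<R}"
    using sub by (simp add: Un_absorb1)
  have "f (\<pi> u) = x u" if u: "u \<in> S'" for u
  proof -
    obtain b where "u \<in> S b" using u by (auto simp: S'_def)
    then show ?thesis using u by (simp add: \<pi>_def xS fT[OF gT])
  qed
  then have "card {u\<in>{..<R}. f (\<pi> u) \<noteq> x u} \<le> card ({..<R} - S')"
    by (intro card_mono) auto
  also have "{..<R} - S' = (\<Union>b\<in>B. P b - S b)"
    using x ST(1) xS by (auto simp: S'_def P_def)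
  also have "card \<dots> \<le> (\<Sum>b\<in>B. card (P b - S b))"
    by (rule card_UN_le[OF B])
  also have "\<dots> = (\<Sum>b\<in>B. card (P b) - card (Q b))"
  proof (rule sum.cong[OF refl])
    fix b
    have "finite (S b)"
      by (rule finite_subset[OF ST(1)]) (simp add: P_def)
    then show "card (P b - S b) = card (P b) - card (Q b)"
      using card_Diff_subset[OF _ ST(1)[of b]] ST(3)[of b] by (simp add: min_def)
  qed
  finally show ?thesis
    using \<pi> unfolding P_def Q_def by blast
qed

text \<open>Labelling \<open>i\<close> by the residue \<open>i mod K\<close> uses every word almost equally often.\<close>
lemma balanced_labelling:
  assumes A: "finite A" "A \<noteq> {}"
  shows "\<exists>f. \<forall>b\<in>words A l. (\<forall>i. f i \<in> words A l) \<and>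
    R div card (words A l) \<le> card {i\<in>{..<R}. f i = b}"
proof -
  define K where "K = card (words A l)"
  obtain e where e: "bij_betw e {0..<K} (words A l)"
    using ex_bij_betw_nat_finite[OF finite_words[OF A(1)]] unfolding K_def by blast
  have K: "K > 0"
    using A by (simp add: K_def card_gt_0_iff finite_words words_nonempty)
  have "R div K \<le> card {i\<in>{..<R}. e (i mod K) = b}" if b: "b \<in> words A l" for b
  proof -
    have "b \<in> e ` {0..<K}" using e b by (simp add: bij_betw_def)
    then obtain k where k: "k < K" "e k = b" by auto
    have "card ((\<lambda>q. q * K + k) ` {..<R div K}) = R div K"
      using K by (subst card_image) (auto simp: inj_on_def)
    moreover have "q * K + k < R" if "q < R div K" for q
    proof -
      have "q * K + k < Suc q * K" using k by simp
      also have "\<dots> \<le> (R div K) * K" using that by (intro mult_le_mono1) simp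
      also have "\<dots> \<le> R" by simp
      finally show ?thesis .
    qed
    then have "(\<lambda>q. q * K + k) ` {..<R div K} \<subseteq> {i\<in>{..<R}. e (i mod K) = b}"
      using k by auto
    then have "card ((\<lambda>q. q * K + k) ` {..<R div K}) \<le> card {i\<in>{..<R}. e (i mod K) = b}"
      by (intro card_mono) auto
    ultimately show ?thesis by simp
  qed
  moreover have "e (i mod K) \<in> words A l" for i
    using bspec[OF bij_betwE[OF e], of "i mod K"] K by simp
  ultimately show ?thesis
    unfolding K_def by (intro exI[of _ "\<lambda>i. e (i mod K)"]) (auto simp: K_def)
qed

lemma block_count_deviation:
  fixes A :: "'a set"
  assumes A: "finite A" "A \<noteq> {}" and b: "b \<in> words A l"
  defines "K \<equiv> real (card (words A l))"
  shows "(\<Sum>x\<in>words A (R * l). (real (card {u\<in>{..<R}. block l u x = b}) - R / K)\<^sup>2) \<le> R * K ^ R / K"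
proof -
  have fin: "finite (words A l)" by (rule finite_words[OF A(1)])
  have K: "K \<ge> 1"
    using A by (simp add: K_def Suc_le_eq card_gt_0_iff finite_words words_nonempty)
  define g :: "'a list \<Rightarrow> real" where "g y = of_bool (y = b) - 1 / K" for y
  have ob: "(\<Sum>y\<in>words A l. of_bool (y = b)) = (1::real)"
    using b fin by (simp add: of_bool_def)
  have g0: "(\<Sum>y\<in>words A l. g y) = 0"
    using K by (simp add: g_def sum_subtractf ob) (simp add: K_def)
  have "(g y)\<^sup>2 = of_bool (y = b) * (1 - 2 / K) + 1 / K\<^sup>2" for y
    by (auto simp: g_def power2_eq_square algebra_simps)
  then have "(\<Sum>y\<in>words A l. (g y)\<^sup>2) = 1 - 2 / K + K * (1 / K\<^sup>2)"
    by (simp add: sum.distrib sum_distrib_right[symmetric] ob) (simp add: K_def)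
  also have "\<dots> \<le> 1"
    using K by (simp add: power2_eq_square)
  finally have g2: "(\<Sum>y\<in>words A l. (g y)\<^sup>2) \<le> 1" .
  have dev: "real (card {u\<in>{..<R}. block l u x = b}) - R / K = (\<Sum>u<R. g (block l u x))" for x
    by (simp add: g_def sum_subtractf of_bool_def sum.If_cases Int_def)
  have "(\<Sum>x\<in>words A (R * l). (\<Sum>u<R. g (block l u x))\<^sup>2) * K = R * K ^ R * (\<Sum>y\<in>words A l. (g y)\<^sup>2)"
    using sum_words_variance[OF A(1) g0, of R] by (simp add: K_def)
  also have "\<dots> \<le> R * K ^ R * 1"
    using K by (intro mult_left_mono g2) auto
  finally show ?thesis
    using K unfolding dev by (simp add: field_simps)
qed

text \<open>The mean number of blocks left unmatched by the best permutation. A free parameter \<open>s\<close> replaces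
  the Cauchy-Schwarz inequality: the deviation \<open>z\<close> of a block count from \<open>R / K\<close> is bounded by
  \<open>z\<^sup>2 / (2 * s) + s / 2\<close>, whose first part is controlled by the variance. With \<open>s\<close> large and \<open>R\<close>
  at least \<open>s\<^sup>2 * K\<close>, the fraction of unmatched blocks is at most \<open>2 / s\<close>.\<close>
lemma exists_good_relabelling:
  fixes A :: "'a set" and l R :: nat
  assumes A: "finite A" "A \<noteq> {}"
  defines "K \<equiv> real (card (words A l))"
  shows "\<exists>f \<pi>. (\<forall>i. f i \<in> words A l) \<and> (\<forall>x\<in>words A (R * l). bij_betw (\<pi> x) {..<R} {..<R}) \<and>
    (\<forall>s>0. (\<Sum>x\<in>words A (R * l). real (card {u\<in>{..<R}. f (\<pi> x u) \<noteq> block l u x})) \<le>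
      (R / (2 * s) + K * s / 2 + K) * card (words A (R * l)))"
proof -
  have fin: "finite (words A l)" "finite (words A (R * l))" using A by (auto intro: finite_words)
  have K: "K \<ge> 1"
    using A by (simp add: K_def Suc_le_eq card_gt_0_iff finite_words words_nonempty)
  have cW: "real (card (words A (R * l))) = K ^ R"
    using A by (simp add: K_def card_words power_mult[symmetric] mult.commute)
  obtain f where f: "\<And>i. f i \<in> words A l"
      and fb: "\<And>b. b \<in> words A l \<Longrightarrow> R div card (words A l) \<le> card {i\<in>{..<R}. f i = b}"
    using balanced_labelling[OF A, of l R] words_nonempty[OF A(2), of l] by blast
  define n where "n x b = card {u\<in>{..<R}. block l u x = b}" for x b :: "'a list"
  have "\<exists>\<pi>. bij_betw \<pi> {..<R} {..<R} \<and> card {u\<in>{..<R}. f (\<pi> u) \<noteq> block l u x} \<le>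
      (\<Sum>b\<in>words A l. n x b - card {i\<in>{..<R}. f i = b})" if "x \<in> words A (R * l)" for x
    unfolding n_def
    by (rule exists_matching_permutation[OF fin(1)]) (use that f block_in_words in auto)
  then have "\<forall>x\<in>words A (R * l). \<exists>p. bij_betw p {..<R} {..<R} \<and>
      card {u\<in>{..<R}. f (p u) \<noteq> block l u x} \<le>
      (\<Sum>b\<in>words A l. n x b - card {i\<in>{..<R}. f i = b})"
    by blast
  from bchoice[OF this]
  obtain \<pi> where \<pi>: "\<And>x. x \<in> words A (R * l) \<Longrightarrow> bij_betw (\<pi> x) {..<R} {..<R}"
      and \<pi>c: "\<And>x. x \<in> words A (R * l) \<Longrightarrow> card {u\<in>{..<R}. f (\<pi> x u) \<noteq> block l u x} \<le>
      (\<Sum>b\<in>words A l. n x b - card {i\<in>{..<R}. f i = b})"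
    by blast
  have "(\<Sum>x\<in>words A (R * l). real (card {u\<in>{..<R}. f (\<pi> x u) \<noteq> block l u x})) \<le>
      (R / (2 * s) + K * s / 2 + K) * card (words A (R * l))" if s: "s > 0" for s :: real
  proof -
    have dev: "real (n x b - card {i\<in>{..<R}. f i = b}) \<le> (real (n x b) - R / K)\<^sup>2 / (2 * s) + (s / 2 + 1)"
      if "b \<in> words A l" for x b
    proof -
      define z where "z = real (n x b) - R / K"
      have "real R / K \<le> real (R div card (words A l)) + 1"
        using floor_correct[of "real R / K"]
          floor_divide_of_nat_eq[where 'a = real, of R "card (words A l)"] by (simp add: K_def)
      then have "R / K - 1 \<le> card {i\<in>{..<R}. f i = b}"
        using fb[OF that] by linarith
      then have *: "real (n x b - card {i\<in>{..<R}. f i = b}) \<le> max 0 (z + 1)"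
        unfolding z_def by linarith
      have "0 \<le> (z - s)\<^sup>2" by simp
      then have "z \<le> z\<^sup>2 / (2 * s) + s / 2"
        using s by (simp add: field_simps power2_eq_square)
      moreover have "0 \<le> z\<^sup>2 / (2 * s) + s / 2" using s by simp
      ultimately show ?thesis using * unfolding z_def[symmetric] by linarith
    qed
    have "real (card {u\<in>{..<R}. f (\<pi> x u) \<noteq> block l u x}) \<le>
        (\<Sum>b\<in>words A l. (real (n x b) - R / K)\<^sup>2 / (2 * s) + (s / 2 + 1))"
      if x: "x \<in> words A (R * l)" for x
    proof -
      have "real (card {u\<in>{..<R}. f (\<pi> x u) \<noteq> block l u x}) \<le>
          (\<Sum>b\<in>words A l. real (n x b - card {i\<in>{..<R}. f i = b}))"
        using \<pi>c[OF x] by (simp flip: of_nat_sum)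
      also have "\<dots> \<le> (\<Sum>b\<in>words A l. (real (n x b) - R / K)\<^sup>2 / (2 * s) + (s / 2 + 1))"
        by (intro sum_mono dev)
      finally show ?thesis .
    qed
    then have "(\<Sum>x\<in>words A (R * l). real (card {u\<in>{..<R}. f (\<pi> x u) \<noteq> block l u x})) \<le>
        (\<Sum>x\<in>words A (R * l). \<Sum>b\<in>words A l. (real (n x b) - R / K)\<^sup>2 / (2 * s) + (s / 2 + 1))"
      by (intro sum_mono)
    also have "\<dots> = (\<Sum>b\<in>words A l. (\<Sum>x\<in>words A (R * l). (real (n x b) - R / K)\<^sup>2) / (2 * s)
        + K ^ R * (s / 2 + 1))"
      by (subst sum.swap) (simp add: sum.distrib sum_divide_distrib cW)
    also have "\<dots> \<le> (\<Sum>b\<in>words A l. (R * K ^ R / K) / (2 * s) + K ^ R * (s / 2 + 1))"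
      using block_count_deviation[OF A, of _ l R] s unfolding n_def K_def
      by (intro sum_mono add_mono divide_right_mono) auto
    also have "\<dots> = K * ((R * K ^ R / K) / (2 * s) + K ^ R * (s / 2 + 1))"
      by (simp add: K_def)
    also have "\<dots> = (R / (2 * s) + K * s / 2 + K) * K ^ R"
      using K s by (simp add: field_simps)
    finally show ?thesis unfolding cW .
  qed
  then show ?thesis using f \<pi> by blast
qed

section \<open>Completed sigma-fields\<close>

text \<open>All equalities of \<open>\<sigma>\<close>-fields are modulo null sets, hence measurability is tested against
  \<open>\<sigma>\<close>-fields enlarged by the null sets of \<open>M\<close>.\<close>
definition completed :: "'w measure \<Rightarrow> 'w set set \<Rightarrow> 'w measure" where
  "completed M \<G> = sigma (space M) (\<G> \<union> null_sets M)"

lemma space_completed [simp]: "space (completed M \<G>) = space M"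
  by (simp add: completed_def space_measure_of_conv)

lemma sets_completed:
  assumes "\<G> \<subseteq> sets M"
  shows "sets (completed M \<G>) = sigma_sets (space M) (\<G> \<union> null_sets M)"
  unfolding completed_def
  by (rule sets_measure_of) (use assms sets.sets_into_space in \<open>auto dest: null_setsD2\<close>)

lemma sets_completed_subset:
  assumes "\<G> \<subseteq> sets M"
  shows "sets (completed M \<G>) \<subseteq> sets M"
  unfolding sets_completed[OF assms] by (rule sets.sigma_sets_subset) (use assms in auto)

lemma measurable_completedD:
  assumes "\<G> \<subseteq> sets M" and "g \<in> measurable (completed M \<G>) S"
  shows "g \<in> measurable M S"
  using measurable_mono[of S S "completed M \<G>" M] sets_completed_subset[OF assms(1)] assms(2) by auto

lemma completedI:
  assumes "\<G> \<subseteq> sets M"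
  shows "E \<in> \<G> \<Longrightarrow> E \<in> sets (completed M \<G>)" and "E \<in> null_sets M \<Longrightarrow> E \<in> sets (completed M \<G>)"
  unfolding sets_completed[OF assms] by (auto intro: sigma_sets.Basic)

lemma completed_subset:
  assumes "\<G> \<subseteq> sets M" and "\<H> \<subseteq> sets M" and "\<G> \<subseteq> sets (completed M \<H>)"
  shows "sets (completed M \<G>) \<subseteq> sets (completed M \<H>)"
proof -
  have "\<G> \<union> null_sets M \<subseteq> sets (completed M \<H>)"
    using assms completedI(2)[of \<H>] by auto
  from sets.sigma_sets_subset[OF this] show ?thesis
    unfolding sets_completed[OF assms(1)] by simp
qed

lemma eq_mod_null_iff_completed:
  assumes "\<G> \<subseteq> sets M" and "\<H> \<subseteq> sets M"
  shows "eq_mod_null M \<G> \<H> \<longleftrightarrow> sets (completed M \<G>) = sets (completed M \<H>)"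
  using assms by (simp add: eq_mod_null_def sets_completed)

lemma completed_approx:
  assumes G: "sigma_algebra (space M) \<G>" "\<G> \<subseteq> sets M" and E: "E \<in> sets (completed M \<G>)"
  shows "\<exists>D\<in>\<G>. AE \<omega> in M. \<omega> \<in> E \<longleftrightarrow> \<omega> \<in> D"
proof -
  interpret G: sigma_algebra "space M" \<G> by fact
  from E have "E \<in> sigma_sets (space M) (\<G> \<union> null_sets M)"
    by (simp add: sets_completed[OF G(2)])
  then show ?thesis
  proof induction
    case (Basic E)
    show ?case
    proof (cases "E \<in> \<G>")
      case True
      then show ?thesis by auto
    next
      case False
      then have "E \<in> null_sets M" using Basic by simp
      then have "AE \<omega> in M. \<omega> \<in> E \<longleftrightarrow> \<omega> \<in> {}" using AE_not_in by fastforce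
      then show ?thesis by blast
    qed
  next
    case Empty
    show ?case by (rule bexI[of _ "{}"]) auto
  next
    case (Compl E)
    then obtain D where D: "D \<in> \<G>" "AE \<omega> in M. \<omega> \<in> E \<longleftrightarrow> \<omega> \<in> D" by blast
    have "AE \<omega> in M. \<omega> \<in> space M - E \<longleftrightarrow> \<omega> \<in> space M - D"
      using D(2) by eventually_elim auto
    then show ?case using D(1) by blast
  next
    case (Union E)
    then obtain D where D: "\<And>i. D i \<in> \<G>" "\<And>i. AE \<omega> in M. \<omega> \<in> E i \<longleftrightarrow> \<omega> \<in> D i" by metis
    have "AE \<omega> in M. \<forall>i. \<omega> \<in> E i \<longleftrightarrow> \<omega> \<in> D i"
      using D(2) by (simp add: AE_all_countable)
    then have "AE \<omega> in M. \<omega> \<in> (\<Union>i. E i) \<longleftrightarrow> \<omega> \<in> (\<Union>i. D i)"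
      by eventually_elim auto
    moreover have "(\<Union>i. D i) \<in> \<G>" using D(1) by auto
    ultimately show ?case by blast
  qed
qed

lemma completed_AE_cong:
  assumes G: "\<G> \<subseteq> sets M" and D: "D \<in> sets (completed M \<G>)" and E: "E \<in> sets M"
    and eq: "AE \<omega> in M. \<omega> \<in> E \<longleftrightarrow> \<omega> \<in> D"
  shows "E \<in> sets (completed M \<G>)"
proof -
  have D': "D \<in> sets M" using sets_completed_subset[OF G] D by blast
  have "D - E \<in> null_sets M" "E - D \<in> null_sets M"
    using D' E eq by (auto simp: AE_iff_null_sets elim: eventually_mono)
  then have "(D - (D - E)) \<union> (E - D) \<in> sets (completed M \<G>)"
    by (intro sets.Un sets.Diff D completedI(2)[OF G])
  moreover have "(D - (D - E)) \<union> (E - D) = E" by blast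
  ultimately show ?thesis by simp
qed

lemma measurable_completed_AE_cong:
  assumes G: "\<G> \<subseteq> sets M" and I: "finite I"
    and f: "f \<in> measurable (completed M \<G>) (count_space I)"
    and g: "g \<in> measurable M (count_space I)"
    and eq: "AE \<omega> in M. g \<omega> = f \<omega>"
  shows "g \<in> measurable (completed M \<G>) (count_space I)"
  unfolding measurable_count_space_eq2[OF I]
proof (intro conjI ballI)
  show "g \<in> space (completed M \<G>) \<rightarrow> I"
    using measurable_space[OF g] by auto
  fix b assume b: "b \<in> I"
  show "g -` {b} \<inter> space (completed M \<G>) \<in> sets (completed M \<G>)"
  proof (rule completed_AE_cong[OF G])
    show "f -` {b} \<inter> space M \<in> sets (completed M \<G>)"
      using measurable_sets[OF f, of "{b}"] b by simp
    show "g -` {b} \<inter> space (completed M \<G>) \<in> sets M"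
      using measurable_sets[OF g, of "{b}"] b by simp
    show "AE \<omega> in M. \<omega> \<in> g -` {b} \<inter> space (completed M \<G>) \<longleftrightarrow> \<omega> \<in> f -` {b} \<inter> space M"
      using eq by eventually_elim auto
  qed
qed

context prob_space
begin

text \<open>Approximation in probability gives measurability: along a summable sequence of errors, the
  Borel-Cantelli lemma turns the approximating events into an almost sure limit.\<close>
lemma completed_limit:
  assumes G: "\<G> \<subseteq> events" and D: "D \<in> events"
    and approx: "\<And>\<epsilon>. \<epsilon> > 0 \<Longrightarrow> \<exists>E\<in>sets (completed M \<G>). prob (sym_diff E D) < \<epsilon>"
  shows "D \<in> sets (completed M \<G>)"
proof -
  have "\<forall>i. \<exists>E\<in>sets (completed M \<G>). prob (sym_diff E D) < (1/2) ^ i"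
    using approx by simp
  then obtain E where E: "\<And>i. E i \<in> sets (completed M \<G>)"
      and small: "\<And>i::nat. prob (sym_diff (E i) D) < (1/2) ^ i" by metis
  have ev: "sym_diff (E i) D \<in> events" for i
    using E D sets_completed_subset[OF G] by blast
  have "AE \<omega> in M. eventually (\<lambda>i. \<omega> \<in> space M - sym_diff (E i) D) sequentially"
  proof (rule borel_cantelli_AE1)
    show "summable (\<lambda>i. prob (sym_diff (E i) D))"
      by (rule summable_comparison_test'[of "\<lambda>i. (1/2) ^ i" 0])
        (use small in \<open>auto intro: less_imp_le simp: summable_geometric_iff\<close>)
  qed (use ev in \<open>auto simp: emeasure_eq_measure\<close>)
  then have "AE \<omega> in M. \<omega> \<in> D \<longleftrightarrow> \<omega> \<in> (\<Union>i. \<Inter>j\<in>{i..}. E j)"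
  proof eventually_elim
    case (elim \<omega>)
    then obtain i where i: "\<And>j. j \<ge> i \<Longrightarrow> \<omega> \<in> E j \<longleftrightarrow> \<omega> \<in> D"
      by (auto simp: eventually_sequentially)
    show ?case
    proof
      assume "\<omega> \<in> D"
      then show "\<omega> \<in> (\<Union>i. \<Inter>j\<in>{i..}. E j)" using i by auto
    next
      assume "\<omega> \<in> (\<Union>i. \<Inter>j\<in>{i..}. E j)"
      then obtain k where "\<And>j. j \<ge> k \<Longrightarrow> \<omega> \<in> E j" by auto
      then show "\<omega> \<in> D" using i[of "max i k"] by simp
    qed
  qed
  moreover have "(\<Union>i. \<Inter>j\<in>{i..}. E j) \<in> sets (completed M \<G>)"
    using E by (intro sets.countable_UN sets.countable_INT') auto
  ultimately show ?thesis
    using completed_AE_cong[OF G _ D] by blast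
qed

lemma prob_completed:
  assumes G: "sigma_algebra (space M) \<G>" "\<G> \<subseteq> events" and B: "B \<in> events"
    and indep: "\<And>D. D \<in> \<G> \<Longrightarrow> prob (B \<inter> D) = c * prob D"
    and E: "E \<in> sets (completed M \<G>)"
  shows "prob (B \<inter> E) = c * prob E"
proof -
  obtain D where D: "D \<in> \<G>" "AE \<omega> in M. \<omega> \<in> E \<longleftrightarrow> \<omega> \<in> D"
    using completed_approx[OF G E] by blast
  have "E \<in> events" "D \<in> events" using E D G(2) sets_completed_subset[OF G(2)] by auto
  then have "prob E = prob D" "prob (B \<inter> E) = prob (B \<inter> D)"
    using D(2) B by (auto intro!: finite_measure_eq_AE elim: eventually_mono)
  then show ?thesis using indep[OF D(1)] by simp
qed

lemma expectation_finite_range: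
  fixes g :: "'c \<Rightarrow> real"
  assumes Y: "Y \<in> measurable M (count_space I)" and I: "finite I"
  shows "expectation (\<lambda>\<omega>. g (Y \<omega>)) = (\<Sum>y\<in>I. g y * prob (Y -` {y} \<inter> space M))"
proof -
  have ev: "Y -` {y} \<inter> space M \<in> events" if "y \<in> I" for y
    using measurable_sets[OF Y, of "{y}"] that by simp
  have "expectation (\<lambda>\<omega>. g (Y \<omega>)) =
      expectation (\<lambda>\<omega>. \<Sum>y\<in>I. g y * indicator (Y -` {y} \<inter> space M) \<omega>)"
  proof (rule Bochner_Integration.integral_cong[OF refl])
    fix \<omega> assume \<omega>: "\<omega> \<in> space M"
    then have "Y \<omega> \<in> I" using measurable_space[OF Y] by simp
    then show "g (Y \<omega>) = (\<Sum>y\<in>I. g y * indicator (Y -` {y} \<inter> space M) \<omega>)"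
      using \<omega> I by (subst sum.remove[of I "Y \<omega>"]) (auto intro!: sum.neutral)
  qed
  also have "\<dots> = (\<Sum>y\<in>I. g y * prob (Y -` {y} \<inter> space M))"
    using ev by (subst Bochner_Integration.integral_sum) (auto simp: emeasure_eq_measure)
  finally show ?thesis .
qed

end

lemma sigma_algebra_sigma_field_of: "sigma_algebra (space M) (sigma_field_of M S Y I)"
  unfolding sigma_field_of_def by (rule sigma_algebra_sigma_sets) auto

lemma sigma_field_of_subset:
  assumes "\<And>m. m \<in> I \<Longrightarrow> Y m \<in> measurable M (S m)"
  shows "sigma_field_of M S Y I \<subseteq> sets M"
  unfolding sigma_field_of_def
  by (rule sets.sigma_sets_subset) (use assms in \<open>auto intro: measurable_sets\<close>)

lemma sigma_field_of_least:
  assumes "space N = space M" and "\<And>m. m \<in> I \<Longrightarrow> Y m \<in> measurable N (S m)"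
  shows "sigma_field_of M S Y I \<subseteq> sets N"
  unfolding sigma_field_of_def assms(1)[symmetric]
  by (rule sets.sigma_sets_subset) (use assms(2) in \<open>auto intro: measurable_sets\<close>)

lemma sigma_field_of_basic:
  "m \<in> I \<Longrightarrow> B \<in> sets (S m) \<Longrightarrow> Y m -` B \<inter> space M \<in> sigma_field_of M S Y I"
  unfolding sigma_field_of_def by (rule sigma_sets.Basic) blast

lemma sigma_field_of_mono: "I \<subseteq> J \<Longrightarrow> sigma_field_of M S Y I \<subseteq> sigma_field_of M S Y J"
  unfolding sigma_field_of_def by (rule sigma_sets_mono') blast

section \<open>Split-word processes over a finite alphabet\<close>
locale finite_split_word_process = split_word_process +
  assumes finite_A: "finite A" and card_A: "2 \<le> card A"
begin

abbreviation "F \<equiv> split_word_filtration M A len X V"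
abbreviation "r \<equiv> split_ratio len"

lemma A_nonempty: "A \<noteq> {}" using card_A by auto

lemma len_pos: "n \<le> 0 \<Longrightarrow> 0 < len n"
  using ratio_ge_2[of n] by (cases "len n = 0") (auto simp: split_ratio_def)

lemma len_ratio: "n \<le> 0 \<Longrightarrow> len (n - 1) = r n * len n"
  using length_dvd[of n] by (simp add: split_ratio_def)

lemma XV_measurable:
  assumes "n \<le> 0"
  shows "(\<lambda>\<omega>. (X n \<omega>, V n \<omega>)) \<in> measurable M (split_word_space A len n)"
  unfolding split_word_space_def by (intro measurable_Pair X_measurable V_measurable assms)

lemma F_sigma_algebra: "sigma_algebra (space M) (F n)"
  unfolding split_word_filtration_def natural_filtration_def by (rule sigma_algebra_sigma_field_of)

lemma F_events: "n \<le> 0 \<Longrightarrow> F n \<subseteq> events"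
  unfolding split_word_filtration_def natural_filtration_def
  by (rule sigma_field_of_subset) (auto intro!: XV_measurable)

lemma F_mono: "m \<le> n \<Longrightarrow> F m \<subseteq> F n"
  unfolding split_word_filtration_def natural_filtration_def by (rule sigma_field_of_mono) auto

lemma F_event: "k \<le> n \<Longrightarrow> {\<omega>\<in>space M. P (X k \<omega>) (V k \<omega>)} \<in> F n" if "n \<le> 0"
proof -
  assume k: "k \<le> n"
  define B where "B = {(x, v) \<in> words A (len k) \<times> {1..r k}. P x v}"
  have "B \<in> sets (split_word_space A len k)"
    unfolding split_word_space_def
    by (subst sets_pair_countable) (auto simp: B_def countable_finite finite_words[OF finite_A])
  then have "(\<lambda>\<omega>. (X k \<omega>, V k \<omega>)) -` B \<inter> space M \<in> F n"
    unfolding split_word_filtration_def natural_filtration_def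
    by (intro sigma_field_of_basic[where Y = "\<lambda>m \<omega>. (X m \<omega>, V m \<omega>)"]) (use k in auto)
  moreover have "(\<lambda>\<omega>. (X k \<omega>, V k \<omega>)) -` B \<inter> space M = {\<omega>\<in>space M. P (X k \<omega>) (V k \<omega>)}"
    using measurable_space[OF X_measurable, of k] measurable_space[OF V_measurable, of k] k that
    by (auto simp: B_def)
  ultimately show ?thesis by simp
qed

lemma X_measurable_completed:
  assumes "k \<le> n" "n \<le> 0"
  shows "X k \<in> measurable (completed M (F n)) (count_space (words A (len k)))"
  unfolding measurable_count_space_eq2[OF finite_words[OF finite_A]]
  using measurable_space[OF X_measurable, of k] assms F_event[OF assms(2,1), of "\<lambda>x v. x = _"]
  by (auto simp: vimage_def Int_def conj_commute intro!: completedI(1) F_events)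

lemma V_measurable_completed:
  assumes "k \<le> n" "n \<le> 0"
  shows "V k \<in> measurable (completed M (F n)) (count_space {1..r k})"
  unfolding measurable_count_space_eq2[OF finite_atLeastAtMost]
  using measurable_space[OF V_measurable, of k] assms F_event[OF assms(2,1), of "\<lambda>x v. v = _"]
  by (auto simp: vimage_def Int_def conj_commute intro!: completedI(1) F_events)

text \<open>The independence of \<open>V n\<close> from the past, in the form used throughout: conditionally on any past
  event, \<open>V n\<close> is uniform.\<close>
lemma V_prob:
  assumes n: "n \<le> 0" and v: "v \<in> {1..r n}" and E: "E \<in> sets (completed M (F (n - 1)))"
  shows "prob ({\<omega>\<in>space M. V n \<omega> = v} \<inter> E) = prob E / r n"
proof -
  let ?B = "V n -` {v} \<inter> space M"
  have B: "?B \<in> events" using measurable_sets[OF V_measurable[OF n], of "{v}"] v by simp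
  have "prob ?B = measure (distr M (count_space {1..r n}) (V n)) {v}"
    by (rule measure_distr[symmetric, OF V_measurable[OF n]]) (use v in simp)
  also have "\<dots> = 1 / r n"
    unfolding V_uniform[OF n] using v by (subst measure_uniform_count_measure) auto
  finally have pB: "prob ?B = 1 / r n" .
  have "?B \<in> sigma_field_of M (\<lambda>m. count_space {1..r m}) V {n}"
    using v by (intro sigma_field_of_basic) auto
  then have indep: "prob (?B \<inter> D) = 1 / r n * prob D" if "D \<in> F (n - 1)" for D
    using indep_setD[OF V_indep[OF n] _ that, of ?B] pB by simp
  have "prob (?B \<inter> E) = 1 / r n * prob E"
    using prob_completed[OF F_sigma_algebra F_events B indep E] n by simp
  moreover have "?B = {\<omega>\<in>space M. V n \<omega> = v}" by auto
  ultimately show ?thesis by simp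
qed

lemma X_prob:
  assumes n: "n \<le> 0" and x: "x \<in> words A (len n)"
  shows "prob (X n -` {x} \<inter> space M) = 1 / card A ^ len n"
proof -
  have "prob (X n -` {x} \<inter> space M) = measure (distr M (count_space (words A (len n))) (X n)) {x}"
    using x n by (subst measure_distr) (auto intro: X_measurable)
  also have "\<dots> = 1 / card A ^ len n"
    unfolding X_uniform[OF n] using x
    by (subst measure_uniform_count_measure) (auto simp: finite_words card_words finite_A)
  finally show ?thesis .
qed

lemma X_expectation:
  fixes g :: "'b list \<Rightarrow> real"
  assumes n: "n \<le> 0"
  shows "expectation (\<lambda>\<omega>. g (X n \<omega>)) = (\<Sum>x\<in>words A (len n). g x) / card A ^ len n"
  by (subst expectation_finite_range[OF X_measurable[OF n] finite_words[OF finite_A]])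
    (simp add: X_prob n sum_divide_distrib)

end

section \<open>Positions of late words inside early words\<close>
lemma (in prob_space) indep_vars_of_successive:
  fixes W :: "int \<Rightarrow> 'a \<Rightarrow> 'c" and N :: "int \<Rightarrow> 'a measure"
  assumes W: "\<And>n. n \<in> I \<Longrightarrow> W n \<in> measurable M (S n)"
    and past: "\<And>m n B. m \<in> I \<Longrightarrow> n \<in> I \<Longrightarrow> m < n \<Longrightarrow> B \<in> sets (S m) \<Longrightarrow> W m -` B \<inter> space M \<in> sets (N n)"
    and indep: "\<And>n B E. n \<in> I \<Longrightarrow> B \<in> sets (S n) \<Longrightarrow> E \<in> sets (N n) \<Longrightarrow>
      prob (W n -` B \<inter> space M \<inter> E) = prob (W n -` B \<inter> space M) * prob E"
  shows "indep_vars S W I"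
  unfolding indep_vars_def2
proof (intro conjI ballI indep_setsI)
  fix n assume "n \<in> I"
  then show "W n \<in> measurable M (S n)" "{W n -` B \<inter> space M |B. B \<in> sets (S n)} \<subseteq> events"
    using W by (auto intro: measurable_sets)
next
  fix E J assume J: "J \<noteq> {}" "J \<subseteq> I" "finite J"
    and E: "\<forall>j\<in>J. E j \<in> {W j -` B \<inter> space M |B. B \<in> sets (S j)}"
  have "prob (\<Inter>j\<in>J. E j) = (\<Prod>j\<in>J. prob (E j))"
    using J(3) J(1,2) E
  proof (induction rule: finite_linorder_max_induct)
    case empty
    then show ?case by simp
  next
    case (insert b J)
    have E: "\<exists>B\<in>sets (S j). E j = W j -` B \<inter> space M" if "j \<in> insert b J" for j
      using bspec[OF insert.prems(3) that] by blast
    obtain B where B: "B \<in> sets (S b)" "E b = W b -` B \<inter> space M"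
      using E[of b] by blast
    show ?case
    proof (cases "J = {}")
      case False
      have "E j \<in> sets (N b)" if "j \<in> J" for j
        using E[of j] insert.prems(2) insert.hyps(2) that past[of j b] by auto
      then have "(\<Inter>j\<in>J. E j) \<in> sets (N b)"
        using False insert.hyps(1) by (intro sets.finite_INT) auto
      then have "prob (E b \<inter> (\<Inter>j\<in>J. E j)) = prob (E b) * prob (\<Inter>j\<in>J. E j)"
        unfolding B(2) using insert.prems by (intro indep B(1)) auto
      then show ?thesis
        using insert.IH insert.prems insert.hyps(1,2) False by auto
    qed (use insert in simp)
  qed
  then show "prob (\<Inter>j\<in>J. E j) = (\<Prod>j\<in>J. prob (E j))" .
qed

context finite_split_word_process
begin

text \<open>The number (from 0) of the block of \<open>X p\<close> that is equal to \<open>X (p + k)\<close>, computed from the digits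
  \<open>V (p + 1), \<dots>, V (p + k)\<close>. It is uniform and independent of the past up to \<open>p\<close>, and it encodes
  these digits.\<close>
primrec pos :: "int \<Rightarrow> nat \<Rightarrow> 'a \<Rightarrow> nat" where
  "pos p 0 \<omega> = 0"
| "pos p (Suc k) \<omega> = pos p k \<omega> * r (p + int k + 1) + (V (p + int k + 1) \<omega> - 1)"

lemma V_bounds: "n \<le> 0 \<Longrightarrow> \<omega> \<in> space M \<Longrightarrow> V n \<omega> \<in> {1..r n}"
  using measurable_space[OF V_measurable, of n] by simp

lemma X_words: "n \<le> 0 \<Longrightarrow> \<omega> \<in> space M \<Longrightarrow> X n \<omega> \<in> words A (len n)"
  using measurable_space[OF X_measurable, of n] by simp

lemma len_dvd: "p + int k \<le> 0 \<Longrightarrow> len (p + int k) dvd len p"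
proof (induction k)
  case (Suc k)
  then have "len (p + int (Suc k)) dvd len (p + int k)"
    using length_dvd[of "p + int (Suc k)"] by (simp add: add.assoc)
  then show ?case using Suc by (auto intro: dvd_trans)
qed simp

lemma ratio_Suc:
  assumes "p + int (Suc k) \<le> 0"
  shows "len p div len (p + int (Suc k)) = (len p div len (p + int k)) * r (p + int k + 1)"
proof -
  have "len p = (len p div len (p + int k)) * len (p + int k)"
    using len_dvd[of p k] assms by simp
  moreover have "len (p + int k) = r (p + int k + 1) * len (p + int (Suc k))"
    using len_ratio[of "p + int k + 1"] assms by (simp add: algebra_simps)
  ultimately have "len p = (len p div len (p + int k)) * r (p + int k + 1) * len (p + int (Suc k))"
    by (metis mult.assoc)
  then have "len p div len (p + int (Suc k)) =
      (len p div len (p + int k)) * r (p + int k + 1) * len (p + int (Suc k)) div len (p + int (Suc k))"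
    by (rule arg_cong)
  then show ?thesis using len_pos[OF assms] by simp
qed

lemma pos_less:
  assumes "p + int k \<le> 0" and "\<omega> \<in> space M"
  shows "pos p k \<omega> < len p div len (p + int k)"
  using assms(1)
proof (induction k)
  case 0
  then show ?case using len_pos[of p] by simp
next
  case (Suc k)
  let ?r = "r (p + int k + 1)"
  have "V (p + int k + 1) \<omega> - 1 < ?r"
    using V_bounds[of "p + int k + 1" \<omega>] assms(2) Suc.prems by auto
  then have "pos p (Suc k) \<omega> < Suc (pos p k \<omega>) * ?r" by simp
  also have "\<dots> \<le> (len p div len (p + int k)) * ?r"
    using Suc by (intro mult_le_mono1) simp
  finally show ?case using ratio_Suc[OF Suc.prems] by simp
qed

lemma pos_Suc_div_mod:
  assumes "p + int k + 1 \<le> 0" and "\<omega> \<in> space M"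
  shows "pos p (Suc k) \<omega> div r (p + int k + 1) = pos p k \<omega>"
    and "pos p (Suc k) \<omega> mod r (p + int k + 1) + 1 = V (p + int k + 1) \<omega>"
proof -
  define v where "v = V (p + int k + 1) \<omega> - 1"
  have v: "v < r (p + int k + 1)" "v + 1 = V (p + int k + 1) \<omega>"
    using V_bounds[OF assms] by (auto simp: v_def)
  have "pos p (Suc k) \<omega> = pos p k \<omega> * r (p + int k + 1) + v"
    by (simp add: v_def)
  then show "pos p (Suc k) \<omega> div r (p + int k + 1) = pos p k \<omega>"
    "pos p (Suc k) \<omega> mod r (p + int k + 1) + 1 = V (p + int k + 1) \<omega>"
    using v by simp_all
qed

lemma X_eq_block_pos:
  assumes "p + int k \<le> 0"
  shows "AE \<omega> in M. X (p + int k) \<omega> = block (len (p + int k)) (pos p k \<omega>) (X p \<omega>)"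
  using assms
proof (induction k)
  case 0
  have "block (len p) 0 (X p \<omega>) = X p \<omega>" if "\<omega> \<in> space M" for \<omega>
    using X_words[OF _ that, of p] 0 by (simp add: block_def words_def)
  then show ?case by (intro AE_I2) simp
next
  case (Suc k)
  define n where "n = p + int k + 1"
  have n: "n \<le> 0" "p + int k = n - 1" "p + int (Suc k) = n" using Suc.prems by (simp_all add: n_def)
  have "AE \<omega> in M. X (n - 1) \<omega> = block (len (n - 1)) (pos p k \<omega>) (X p \<omega>)"
    using Suc.IH Suc.prems n(2) by simp
  with X_split[OF n(1)] AE_space have
    "AE \<omega> in M. X n \<omega> = block (len n) (pos p (Suc k) \<omega>) (X p \<omega>)"
  proof eventually_elim
    case (elim \<omega>)
    have "V n \<omega> - 1 < r n" using V_bounds[OF n(1) elim(2)] by auto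
    then show ?case
      using elim by (simp add: subword_eq_block len_ratio[OF n(1)] block_block n_def[symmetric])
  qed
  then show ?case using n(3) by simp
qed

lemma V_from_pos:
  assumes "p + int k \<le> 0"
  shows "\<exists>g. \<forall>\<omega>\<in>space M. \<forall>j\<in>{p<..p + int k}. V j \<omega> = g j (pos p k \<omega>)"
  using assms
proof (induction k)
  case (Suc k)
  then obtain g where g: "\<forall>\<omega>\<in>space M. \<forall>j\<in>{p<..p + int k}. V j \<omega> = g j (pos p k \<omega>)" by auto
  define n where "n = p + int k + 1"
  define g' where "g' j u = (if j = n then u mod r n + 1 else g j (u div r n))" for j u
  have "V j \<omega> = g' j (pos p (Suc k) \<omega>)" if \<omega>: "\<omega> \<in> space M" and j: "j \<in> {p<..p + int (Suc k)}" for \<omega> j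
  proof -
    have "pos p (Suc k) \<omega> div r n = pos p k \<omega>" "pos p (Suc k) \<omega> mod r n + 1 = V n \<omega>"
      using pos_Suc_div_mod[of p k \<omega>] \<omega> Suc.prems by (simp_all add: n_def del: pos.simps)
    then show ?thesis
      using g \<omega> j by (auto simp: g'_def n_def simp del: pos.simps)
  qed
  then show ?case by blast
qed simp

lemma measurable_count_space_UNIV:
  "f \<in> measurable N (count_space I) \<Longrightarrow> f \<in> measurable N (count_space UNIV)"
  by (rule measurable_compose[where N = "count_space I" and g = "\<lambda>x. x"]) auto

lemma pos_measurable:
  assumes "\<And>j. j \<in> {p<..p + int k} \<Longrightarrow> V j \<in> measurable N (count_space UNIV)"
  shows "pos p k \<in> measurable N (count_space UNIV)"
  using assms
proof (induction k)
  case 0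
  have "pos p 0 = (\<lambda>_. 0)" by auto
  then show ?case by simp
next
  case (Suc k)
  have V: "V (p + int k + 1) \<in> measurable N (count_space UNIV)"
    by (rule Suc.prems) simp
  have pos: "pos p k \<in> measurable N (count_space UNIV)"
    by (rule Suc.IH) (use Suc.prems in auto)
  have "(\<lambda>\<omega>. pos p k \<omega> * r (p + int k + 1) + (V (p + int k + 1) \<omega> - 1))
      \<in> measurable N (count_space UNIV)"
    by (rule measurable_compose_countable[OF _ pos], rule measurable_compose_countable[OF _ V]) simp
  then show ?case by simp
qed

lemma pos_event:
  assumes "p + int k \<le> 0"
  shows "{\<omega>\<in>space M. pos p k \<omega> = u} \<in> sets (completed M (F (p + int k)))"
proof -
  have "pos p k \<in> measurable (completed M (F (p + int k))) (count_space UNIV)"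
    by (rule pos_measurable, rule measurable_count_space_UNIV[OF V_measurable_completed])
      (use assms in auto)
  from measurable_sets[OF this, of "{u}"] show ?thesis
    by (simp add: vimage_def Int_def conj_commute)
qed

lemma completed_F_mono:
  assumes "m \<le> n" "n \<le> 0"
  shows "sets (completed M (F m)) \<subseteq> sets (completed M (F n))"
  by (rule completed_subset) (use assms F_events[of m] F_events[of n] F_mono[of m n] in
    \<open>auto intro: completedI(1)\<close>)

lemma pos_prob:
  assumes "p + int k \<le> 0" and E: "E \<in> sets (completed M (F p))"
    and "u < len p div len (p + int k)"
  shows "prob ({\<omega>\<in>space M. pos p k \<omega> = u} \<inter> E) = prob E / real (len p div len (p + int k))"
  using assms(1,3)
proof (induction k arbitrary: u)
  case 0
  have "E \<in> events" using E sets_completed_subset[OF F_events[of p]] 0 by auto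
  then have "{\<omega>\<in>space M. pos p 0 \<omega> = u} \<inter> E = E"
    using 0 len_pos[of p] sets.sets_into_space[of E M] by auto
  then show ?case using 0 len_pos[of p] by simp
next
  case (Suc k)
  define n where "n = p + int k + 1"
  let ?R = "len p div len (p + int k)"
  have n: "n \<le> 0" "n - 1 = p + int k" using Suc.prems by (auto simp: n_def)
  have R: "len p div len (p + int (Suc k)) = ?R * r n"
    using ratio_Suc[OF Suc.prems(1)] by (simp add: n_def)
  have r: "r n > 0" using ratio_ge_2[OF n(1)] by simp
  have u: "u div r n < ?R"
    using Suc.prems(2) R by (simp add: less_mult_imp_div_less)
  have eq: "pos p (Suc k) \<omega> = u \<longleftrightarrow> V n \<omega> = u mod r n + 1 \<and> pos p k \<omega> = u div r n"
    if "\<omega> \<in> space M" for \<omega>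
  proof -
    have "pos p (Suc k) \<omega> div r n = pos p k \<omega>" "pos p (Suc k) \<omega> mod r n + 1 = V n \<omega>"
      using pos_Suc_div_mod[of p k \<omega>] that Suc.prems by (simp_all add: n_def del: pos.simps)
    then show ?thesis
      by (metis add_right_cancel div_mult_mod_eq)
  qed
  have "E \<in> sets (completed M (F (n - 1)))"
    using E completed_F_mono[of p "n - 1"] n by auto
  then have E': "{\<omega>\<in>space M. pos p k \<omega> = u div r n} \<inter> E \<in> sets (completed M (F (n - 1)))"
    using pos_event[of p k] n by auto
  have "{\<omega>\<in>space M. pos p (Suc k) \<omega> = u} \<inter> E =
      {\<omega>\<in>space M. V n \<omega> = u mod r n + 1} \<inter> ({\<omega>\<in>space M. pos p k \<omega> = u div r n} \<inter> E)"
    using eq by auto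
  also have "prob \<dots> = prob ({\<omega>\<in>space M. pos p k \<omega> = u div r n} \<inter> E) / r n"
    by (rule V_prob[OF n(1) _ E']) (use r in \<open>simp add: Suc_le_eq\<close>)
  also have "\<dots> = prob E / (?R * r n)"
    using Suc.IH[OF _ u] Suc.prems(1) by simp
  finally show ?case using R by simp
qed

end

section \<open>Extracted filtrations and their new innovations\<close>
locale extracted_split_word_process = finite_split_word_process M A len X V
  for M :: "'w measure" and A :: "'a set" and len X V +
  fixes \<phi> :: "int \<Rightarrow> int"
  assumes \<phi>_nonpos: "\<And>n. n \<le> 0 \<Longrightarrow> \<phi> n \<le> 0"
    and \<phi>_less: "\<And>n. n \<le> 0 \<Longrightarrow> \<phi> (n - 1) < \<phi> n"
begin

definition K :: "int \<Rightarrow> real" where "K n = real (card (words A (len (\<phi> n))))"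
definition R :: "int \<Rightarrow> nat" where "R n = len (\<phi> (n - 1)) div len (\<phi> n)"
definition U :: "int \<Rightarrow> 'w \<Rightarrow> nat" where "U n = pos (\<phi> (n - 1)) (nat (\<phi> n - \<phi> (n - 1)))"

text \<open>The pair \<open>f\<close>, \<open>\<pi>\<close> consists of the prediction of the word at time \<open>\<phi> n\<close> from the new innovation
  and of the permutations of block numbers that define this innovation; the last condition says
  that the prediction is as good as \<open>exists_good_relabelling\<close> allows.\<close>
definition relabelling :: "int \<Rightarrow> (nat \<Rightarrow> 'a list) \<Rightarrow> ('a list \<Rightarrow> nat \<Rightarrow> nat) \<Rightarrow> bool" where
  "relabelling n f \<pi> \<longleftrightarrow> (\<forall>i. f i \<in> words A (len (\<phi> n))) \<and>
    (\<forall>x\<in>words A (len (\<phi> (n - 1))). bij_betw (\<pi> x) {..<R n} {..<R n}) \<and>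
    (\<forall>s>0. (\<Sum>x\<in>words A (len (\<phi> (n - 1))). real (card {u\<in>{..<R n}. f (\<pi> x u) \<noteq> block (len (\<phi> n)) u x})) \<le>
      (R n / (2 * s) + K n * s / 2 + K n) * card (words A (len (\<phi> (n - 1)))))"

lemma \<phi>_step:
  assumes "n \<le> 0"
  shows "\<phi> (n - 1) + int (nat (\<phi> n - \<phi> (n - 1))) = \<phi> n"
  using \<phi>_less[OF assms] by simp

lemma len_eq_R: "n \<le> 0 \<Longrightarrow> len (\<phi> (n - 1)) = R n * len (\<phi> n)"
  using len_dvd[of "\<phi> (n - 1)" "nat (\<phi> n - \<phi> (n - 1))"] \<phi>_step[of n] \<phi>_nonpos[of n]
  by (simp add: R_def)

lemma R_pos: "n \<le> 0 \<Longrightarrow> 0 < R n"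
  using len_eq_R[of n] len_pos[of "\<phi> (n - 1)"] \<phi>_nonpos[of "n - 1"] by (cases "R n") auto

lemma exists_relabelling:
  assumes n: "n \<le> 0"
  shows "\<exists>f \<pi>. relabelling n f \<pi>"
  using exists_good_relabelling[OF finite_A A_nonempty, of "len (\<phi> n)" "R n"]
  unfolding relabelling_def K_def len_eq_R[OF n] .

lemma U_less: "n \<le> 0 \<Longrightarrow> \<omega> \<in> space M \<Longrightarrow> U n \<omega> < R n"
  using pos_less[of "\<phi> (n - 1)" "nat (\<phi> n - \<phi> (n - 1))" \<omega>] \<phi>_step[of n] \<phi>_nonpos[of n]
  by (simp add: R_def U_def)

lemma U_prob:
  assumes "n \<le> 0" "u < R n" "E \<in> sets (completed M (F (\<phi> (n - 1))))"
  shows "prob ({\<omega>\<in>space M. U n \<omega> = u} \<inter> E) = prob E / R n"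
  using pos_prob[of "\<phi> (n - 1)" "nat (\<phi> n - \<phi> (n - 1))" E u] \<phi>_step[of n] \<phi>_nonpos[of n] assms
  by (simp add: R_def U_def)

lemma X_eq_block_U:
  assumes "n \<le> 0"
  shows "AE \<omega> in M. X (\<phi> n) \<omega> = block (len (\<phi> n)) (U n \<omega>) (X (\<phi> (n - 1)) \<omega>)"
  using X_eq_block_pos[of "\<phi> (n - 1)" "nat (\<phi> n - \<phi> (n - 1))"] \<phi>_step[of n] \<phi>_nonpos[of n] assms
  by (simp add: U_def)

lemma U_measurable:
  assumes "n \<le> 0"
  shows "U n \<in> measurable (completed M (F (\<phi> n))) (count_space UNIV)"
  unfolding U_def
  by (rule pos_measurable, rule measurable_count_space_UNIV[OF V_measurable_completed])
    (use assms \<phi>_step[of n] \<phi>_nonpos[of n] in auto)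

lemma \<phi>_mono: "m \<le> n \<Longrightarrow> n \<le> 0 \<Longrightarrow> \<phi> m \<le> \<phi> n"
proof (induction n rule: int_ge_induct)
  case (step i)
  then show ?case using \<phi>_less[of "i + 1"] by simp
qed simp

lemma \<phi>_le: "n \<le> 0 \<Longrightarrow> \<phi> n \<le> n"
proof (induction n rule: int_le_induct)
  case base
  then show ?case using \<phi>_nonpos[of 0] by simp
next
  case (step i)
  then show ?case using \<phi>_less[of i] by simp
qed

lemma level_between:
  assumes "n \<le> 0" "j \<le> \<phi> n"
  shows "\<exists>m\<le>n. \<phi> (m - 1) < j \<and> j \<le> \<phi> m"
  using assms
proof (induction "nat (n - j)" arbitrary: n rule: less_induct)
  case less
  show ?case
  proof (cases "\<phi> (n - 1) < j")
    case True
    then show ?thesis using less.prems by auto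
  next
    case False
    have "nat (n - 1 - j) < nat (n - j)"
      using less.prems \<phi>_le[of n] False \<phi>_less[of n] by simp
    from less.hyps[OF this] less.prems False obtain m where "m \<le> n - 1" "\<phi> (m - 1) < j" "j \<le> \<phi> m"
      by auto
    then show ?thesis by (intro exI[of _ m]) auto
  qed
qed

end

locale relabelled_split_word_process = extracted_split_word_process +
  fixes f :: "int \<Rightarrow> nat \<Rightarrow> 'b list" and \<pi> :: "int \<Rightarrow> 'b list \<Rightarrow> nat \<Rightarrow> nat"
  assumes relabelling: "\<And>n. n \<le> 0 \<Longrightarrow> relabelling n (f n) (\<pi> n)"
begin

definition W :: "int \<Rightarrow> 'a \<Rightarrow> nat" where "W n \<omega> = \<pi> n (X (\<phi> (n - 1)) \<omega>) (U n \<omega>)"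

definition \<G> :: "int \<Rightarrow> 'a set set" where "\<G> = natural_filtration M (\<lambda>_. count_space UNIV) W"

lemma X_words':
  "n \<le> 0 \<Longrightarrow> \<omega> \<in> space M \<Longrightarrow> X (\<phi> (n - 1)) \<omega> \<in> words A (len (\<phi> (n - 1)))"
  using X_words[of "\<phi> (n - 1)" \<omega>] \<phi>_nonpos[of "n - 1"] by simp

lemma \<pi>_bij: "n \<le> 0 \<Longrightarrow> x \<in> words A (len (\<phi> (n - 1))) \<Longrightarrow> bij_betw (\<pi> n x) {..<R n} {..<R n}"
  using relabelling[of n] by (simp add: relabelling_def)

lemma W_less: "n \<le> 0 \<Longrightarrow> \<omega> \<in> space M \<Longrightarrow> W n \<omega> < R n"
  using bij_betwE[OF \<pi>_bij[OF _ X_words']] U_less unfolding W_def by simp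

lemma U_from_W:
  "n \<le> 0 \<Longrightarrow> \<omega> \<in> space M \<Longrightarrow> U n \<omega> = inv_into {..<R n} (\<pi> n (X (\<phi> (n - 1)) \<omega>)) (W n \<omega>)"
  using bij_betw_imp_inj_on[OF \<pi>_bij[OF _ X_words']] U_less unfolding W_def by simp

lemma W_measurable_completed:
  assumes n: "n \<le> 0"
  shows "W n \<in> measurable (completed M (F (\<phi> n))) (count_space UNIV)"
proof -
  have X: "X (\<phi> (n - 1)) \<in> measurable (completed M (F (\<phi> n))) (count_space (words A (len (\<phi> (n - 1)))))"
    using \<phi>_less[OF n] \<phi>_nonpos[OF n] by (intro X_measurable_completed) auto
  have "(\<lambda>\<omega>. \<pi> n (X (\<phi> (n - 1)) \<omega>) (U n \<omega>)) \<in> measurable (completed M (F (\<phi> n))) (count_space UNIV)"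
    by (rule measurable_compose_countable'[OF _ X countable_finite[OF finite_words[OF finite_A]]],
      rule measurable_compose[OF U_measurable[OF n]]) simp
  then show ?thesis unfolding W_def[abs_def] .
qed

lemma W_measurable: "n \<le> 0 \<Longrightarrow> W n \<in> measurable M (count_space UNIV)"
  by (rule measurable_completedD[OF F_events W_measurable_completed]) (auto intro: \<phi>_nonpos)

text \<open>A permutation chosen according to the past maps a block number that is uniform given the past to
  one that is uniform given the past.\<close>
lemma W_prob_singleton:
  assumes n: "n \<le> 0" and i: "i < R n" and E: "E \<in> sets (completed M (F (\<phi> (n - 1))))"
  shows "prob ({\<omega>\<in>space M. W n \<omega> = i} \<inter> E) = prob E / R n"
proof -
  let ?p = "\<phi> (n - 1)" let ?I = "words A (len ?p)"
  define E' where "E' x = {\<omega>\<in>space M. X ?p \<omega> = x} \<inter> E" for x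
  define u where "u x = inv_into {..<R n} (\<pi> n x) i" for x
  have p: "?p \<le> 0" using \<phi>_nonpos[of "n - 1"] n by simp
  have E': "E' x \<in> sets (completed M (F ?p))" for x
    unfolding E'_def using completedI(1)[OF F_events[OF p] F_event[OF p order_refl, of "\<lambda>y v. y = x"]] E
    by auto
  have Ev: "E \<in> events" "E' x \<in> events" for x
    using E E' sets_completed_subset[OF F_events[OF p]] by auto
  have Uev: "{\<omega>\<in>space M. U n \<omega> = v} \<in> events" for v
    using measurable_sets[OF measurable_completedD[OF F_events U_measurable], of n "{v}"] n \<phi>_nonpos[OF n]
    by (simp add: vimage_def Int_def conj_commute)
  have u: "u x < R n" "\<pi> n x (u x) = i" if "x \<in> ?I" for x
    using \<pi>_bij[OF n that] i unfolding u_def bij_betw_def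
    by (metis inv_into_into lessThan_iff, metis f_inv_into_f lessThan_iff)
  have Wu: "W n \<omega> = i \<longleftrightarrow> U n \<omega> = u (X ?p \<omega>)" if "\<omega> \<in> space M" for \<omega>
    using u[OF X_words'[OF n that]] U_from_W[OF n that] unfolding W_def u_def by auto
  have "{\<omega>\<in>space M. W n \<omega> = i} \<inter> E = (\<Union>x\<in>?I. {\<omega>\<in>space M. U n \<omega> = u x} \<inter> E' x)"
    using Wu X_words'[OF n] by (auto simp: E'_def)
  also have "prob \<dots> = (\<Sum>x\<in>?I. prob ({\<omega>\<in>space M. U n \<omega> = u x} \<inter> E' x))"
    using Uev Ev by (intro finite_measure_finite_Union finite_words finite_A)
      (auto simp: disjoint_family_on_def E'_def)
  also have "\<dots> = (\<Sum>x\<in>?I. prob (E' x) / R n)"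
    using U_prob[OF n _ E'] u by (intro sum.cong) auto
  also have "\<dots> = prob (\<Union>x\<in>?I. E' x) / R n"
    using Ev by (subst finite_measure_finite_Union)
      (auto simp: disjoint_family_on_def E'_def sum_divide_distrib finite_words finite_A)
  also have "(\<Union>x\<in>?I. E' x) = E"
    using X_words'[OF n] sets.sets_into_space[OF Ev(1)] by (auto simp: E'_def)
  finally show ?thesis .
qed

lemma W_prob:
  assumes n: "n \<le> 0" and E: "E \<in> sets (completed M (F (\<phi> (n - 1))))"
  shows "prob (W n -` B \<inter> space M \<inter> E) = card (B \<inter> {..<R n}) / R n * prob E"
proof -
  have E': "E \<in> events"
    using E sets_completed_subset[OF F_events[of "\<phi> (n - 1)"]] \<phi>_nonpos[of "n - 1"] n by auto
  have ev: "{\<omega>\<in>space M. W n \<omega> = i} \<in> events" for i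
    using measurable_sets[OF W_measurable[OF n], of "{i}"]
    by (simp add: vimage_def Int_def conj_commute)
  have "W n -` B \<inter> space M \<inter> E = (\<Union>i\<in>B \<inter> {..<R n}. {\<omega>\<in>space M. W n \<omega> = i} \<inter> E)"
    using W_less[OF n] by auto
  also have "prob \<dots> = (\<Sum>i\<in>B \<inter> {..<R n}. prob ({\<omega>\<in>space M. W n \<omega> = i} \<inter> E))"
    using ev E' by (intro finite_measure_finite_Union) (auto simp: disjoint_family_on_def)
  also have "\<dots> = (\<Sum>i\<in>B \<inter> {..<R n}. prob E / R n)"
    using W_prob_singleton[OF n _ E] by (intro sum.cong) auto
  finally show ?thesis by simp
qed

lemma W_indep: "indep_vars (\<lambda>_. count_space UNIV) W {..0}"
proof (rule indep_vars_of_successive[where N = "\<lambda>n. completed M (F (\<phi> (n - 1)))"])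
  fix m n :: int and B :: "nat set" assume mn: "m \<in> {..0}" "n \<in> {..0}" "m < n"
  have "W m -` B \<inter> space M \<in> sets (completed M (F (\<phi> m)))"
    using measurable_sets[OF W_measurable_completed[of m], of B] mn by simp
  then show "W m -` B \<inter> space M \<in> sets (completed M (F (\<phi> (n - 1))))"
    using completed_F_mono[OF \<phi>_mono[of m "n - 1"] \<phi>_nonpos[of "n - 1"]] mn by auto
next
  fix n :: int and B :: "nat set" and E
  assume n: "n \<in> {..0}" and E: "E \<in> sets (completed M (F (\<phi> (n - 1))))"
  have "space M \<in> sets (completed M (F (\<phi> (n - 1))))"
    using sets.top[of "completed M (F (\<phi> (n - 1)))"] by simp
  from W_prob[OF _ this, of B] W_prob[OF _ E, of B] n
  show "prob (W n -` B \<inter> space M \<inter> E) = prob (W n -` B \<inter> space M) * prob E"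
    by (simp add: prob_space Int_absorb2)
qed (simp add: W_measurable)

lemma \<G>_events: "n \<le> 0 \<Longrightarrow> \<G> n \<subseteq> events"
  unfolding \<G>_def natural_filtration_def by (rule sigma_field_of_subset) (auto intro: W_measurable)

lemma \<G>_subset_F:
  assumes n: "n \<le> 0"
  shows "\<G> n \<subseteq> sets (completed M (F (\<phi> n)))"
  unfolding \<G>_def natural_filtration_def
proof (rule sigma_field_of_least)
  fix m assume m: "m \<in> {..n}"
  then have "sets (completed M (F (\<phi> m))) \<subseteq> sets (completed M (F (\<phi> n)))"
    using n by (intro completed_F_mono \<phi>_mono \<phi>_nonpos) auto
  then show "W m \<in> measurable (completed M (F (\<phi> n))) (count_space UNIV)"
    using W_measurable_completed[of m] measurable_mono[of "count_space UNIV" "count_space UNIV"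
      "completed M (F (\<phi> m))" "completed M (F (\<phi> n))"] m n by auto
qed simp

lemma measurable_completed_\<G>_mono:
  assumes "g \<in> measurable (completed M (\<G> m)) S" "m \<le> n" "n \<le> 0"
  shows "g \<in> measurable (completed M (\<G> n)) S"
proof -
  have "\<G> m \<subseteq> \<G> n"
    unfolding \<G>_def natural_filtration_def using assms(2) by (intro sigma_field_of_mono) auto
  then have "sets (completed M (\<G> m)) \<subseteq> sets (completed M (\<G> n))"
    using assms \<G>_events[of n] \<G>_events[of m] by (intro completed_subset) (auto intro: completedI(1))
  then show ?thesis
    using assms(1) measurable_mono[of S S "completed M (\<G> m)" "completed M (\<G> n)"] by auto
qed

lemma W_measurable_\<G>:
  assumes "n \<le> 0"
  shows "W n \<in> measurable (completed M (\<G> n)) (count_space UNIV)"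
proof (rule measurableI)
  fix B :: "nat set"
  have "W n -` B \<inter> space M \<in> \<G> n"
    unfolding \<G>_def natural_filtration_def by (rule sigma_field_of_basic) auto
  then show "W n -` B \<inter> space (completed M (\<G> n)) \<in> sets (completed M (\<G> n))"
    using completedI(1)[OF \<G>_events[OF assms]] by simp
qed simp

end

context relabelled_split_word_process
begin

section \<open>Recovering the words from the new innovations\<close>

text \<open>Up to a null set, the prediction fails exactly on the pairs of a word and an unmatched block, and
  all pairs of a word and a block are equally likely.\<close>
lemma W_guess_error:
  assumes n: "n \<le> 0" and s: "s > 0"
  shows "prob {\<omega>\<in>space M. f n (W n \<omega>) \<noteq> X (\<phi> n) \<omega>} \<le> 1 / (2 * s) + K n * s / (2 * R n) + K n / R n"
proof -
  let ?p = "\<phi> (n - 1)" let ?I = "words A (len ?p)"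
  have p: "?p \<le> 0" using \<phi>_nonpos[of "n - 1"] n by simp
  define D where "D x = {u\<in>{..<R n}. f n (\<pi> n x u) \<noteq> block (len (\<phi> n)) u x}" for x
  have Xev: "{\<omega>\<in>space M. X ?p \<omega> = x} \<in> sets (completed M (F ?p))" for x
    using completedI(1)[OF F_events[OF p] F_event[OF p order_refl, of "\<lambda>y v. y = x"]] .
  then have Xev': "{\<omega>\<in>space M. X ?p \<omega> = x} \<in> events" for x
    using sets_completed_subset[OF F_events[OF p]] by auto
  have Uev: "{\<omega>\<in>space M. U n \<omega> = v} \<in> events" for v
    using measurable_sets[OF measurable_completedD[OF F_events U_measurable], of n "{v}"] n \<phi>_nonpos[OF n]
    by (simp add: vimage_def Int_def conj_commute)
  have cell: "prob ({\<omega>\<in>space M. U n \<omega> = u} \<inter> {\<omega>\<in>space M. X ?p \<omega> = x}) = 1 / card A ^ len ?p / R n"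
    if "u < R n" "x \<in> ?I" for u x
    using U_prob[OF n that(1) Xev] X_prob[OF p that(2)] by (simp add: vimage_def Int_def conj_commute)
  let ?S = "SIGMA x:?I. D x"
  let ?C = "\<lambda>(x, u). {\<omega>\<in>space M. U n \<omega> = u} \<inter> {\<omega>\<in>space M. X ?p \<omega> = x}"
  have finS: "finite ?S" by (auto simp: D_def finite_words finite_A)
  have Uw: "(\<Union>c\<in>?S. ?C c) \<in> events"
    using finS Uev Xev' by (intro sets.finite_UN) auto
  have "prob {\<omega>\<in>space M. f n (W n \<omega>) \<noteq> X (\<phi> n) \<omega>} \<le> prob (\<Union>c\<in>?S. ?C c)"
  proof (rule finite_measure_mono_AE[OF _ Uw])
    show "AE \<omega> in M. \<omega> \<in> {\<omega>\<in>space M. f n (W n \<omega>) \<noteq> X (\<phi> n) \<omega>} \<longrightarrow> \<omega> \<in> (\<Union>c\<in>?S. ?C c)"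
      using X_eq_block_U[OF n]
    proof eventually_elim
      case (elim \<omega>)
      show ?case
      proof
        assume "\<omega> \<in> {\<omega>\<in>space M. f n (W n \<omega>) \<noteq> X (\<phi> n) \<omega>}"
        then have "(X ?p \<omega>, U n \<omega>) \<in> ?S" "\<omega> \<in> ?C (X ?p \<omega>, U n \<omega>)"
          using elim X_words'[OF n, of \<omega>] U_less[OF n, of \<omega>] by (auto simp: D_def W_def)
        then show "\<omega> \<in> (\<Union>c\<in>?S. ?C c)" by blast
      qed
    qed
  qed
  also have "\<dots> = (\<Sum>c\<in>?S. prob (?C c))"
    using Uev Xev' finS by (intro finite_measure_finite_Union) (auto simp: disjoint_family_on_def)
  also have "\<dots> = (\<Sum>c\<in>?S. 1 / card A ^ len ?p / R n)"
    using cell by (intro sum.cong) (auto simp: D_def)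
  also have "\<dots> = (\<Sum>x\<in>?I. real (card (D x))) / (card A ^ len ?p * R n)"
    by (simp add: card_SigmaI finite_words finite_A D_def)
  also have "\<dots> \<le> (R n / (2 * s) + K n * s / 2 + K n) * card ?I / (card A ^ len ?p * R n)"
    using relabelling[OF n] s unfolding relabelling_def D_def by (intro divide_right_mono) auto
  also have "\<dots> = (R n / (2 * s) + K n * s / 2 + K n) / R n"
    using A_nonempty by (simp add: card_words finite_A)
  also have "\<dots> = 1 / (2 * s) + K n * s / (2 * R n) + K n / R n"
    using R_pos[OF n] s by (simp add: field_simps)
  finally show ?thesis .
qed

text \<open>Measurability of the words with respect to the new innovations is obtained through
  approximations: they start at a level where the prediction is good and keep their error at all
  later levels, because there the next word is computed from the present one and from \<open>W\<close>.\<close>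
definition approximable :: "int \<Rightarrow> real \<Rightarrow> bool" where
  "approximable n \<epsilon> \<longleftrightarrow> (\<exists>Y\<in>measurable (completed M (\<G> n)) (count_space (words A (len (\<phi> n)))).
     prob {\<omega>\<in>space M. Y \<omega> \<noteq> X (\<phi> n) \<omega>} \<le> \<epsilon>)"

lemma neq_event:
  assumes "n \<le> 0" "Y \<in> measurable M (count_space (words A (len n)))"
  shows "{\<omega>\<in>space M. Y \<omega> \<noteq> X n \<omega>} \<in> events"
proof -
  have "Y -` {x} \<inter> space M \<in> events" "X n -` {x} \<inter> space M \<in> events" if "x \<in> words A (len n)" for x
    using measurable_sets[OF assms(2), of "{x}"] measurable_sets[OF X_measurable[OF assms(1)], of "{x}"]
      that by auto
  then have "space M - (\<Union>x\<in>words A (len n). (Y -` {x} \<inter> space M) \<inter> (X n -` {x} \<inter> space M)) \<in> events"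
    by (intro sets.Diff sets.top sets.finite_UN finite_words finite_A) (rule sets.Int)
  moreover have "{\<omega>\<in>space M. Y \<omega> \<noteq> X n \<omega>} = space M - (\<Union>x\<in>words A (len n).
      (Y -` {x} \<inter> space M) \<inter> (X n -` {x} \<inter> space M))"
    using X_words[OF assms(1)] by auto
  ultimately show ?thesis by simp
qed

lemma approximable_start:
  assumes n: "n \<le> 0" and t: "t \<ge> 1" and R: "t\<^sup>2 * K n \<le> R n"
  shows "approximable n (2 / t)"
  unfolding approximable_def
proof (rule bexI)
  have "f n i \<in> words A (len (\<phi> n))" for i
    using relabelling[OF n] by (simp add: relabelling_def)
  then show "(\<lambda>\<omega>. f n (W n \<omega>)) \<in> measurable (completed M (\<G> n)) (count_space (words A (len (\<phi> n))))"
    by (intro measurable_compose[OF W_measurable_\<G>[OF n]]) auto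
  have "K n / R n \<le> 1 / t\<^sup>2"
    using R R_pos[OF n] t by (simp add: field_simps)
  moreover have "1 / t\<^sup>2 \<le> 1 / t"
    using t by (simp add: field_simps power2_eq_square)
  moreover have "K n / R n * (t / 2) \<le> 1 / t\<^sup>2 * (t / 2)"
    using \<open>K n / R n \<le> 1 / t\<^sup>2\<close> t by (intro mult_right_mono) auto
  then have "K n * t / (2 * R n) \<le> 1 / (2 * t)"
    using t by (simp add: power2_eq_square mult.commute)
  ultimately have "1 / (2 * t) + K n * t / (2 * R n) + K n / R n \<le> 2 / t"
    by simp
  then show "prob {\<omega>\<in>space M. f n (W n \<omega>) \<noteq> X (\<phi> n) \<omega>} \<le> 2 / t"
    using W_guess_error[OF n, of t] t by simp
qed

lemma approximable_step:
  assumes n: "n \<le> 0" and approx: "approximable (n - 1) \<epsilon>"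
  shows "approximable n \<epsilon>"
proof -
  let ?p = "\<phi> (n - 1)"
  have p: "?p \<le> 0" using \<phi>_nonpos[of "n - 1"] n by simp
  obtain Y where Y: "Y \<in> measurable (completed M (\<G> (n - 1))) (count_space (words A (len ?p)))"
    and err: "prob {\<omega>\<in>space M. Y \<omega> \<noteq> X ?p \<omega>} \<le> \<epsilon>"
    using approx unfolding approximable_def by blast
  define g where "g x i = block (len (\<phi> n)) (inv_into {..<R n} (\<pi> n x) i) x" for x i
  \<comment> \<open>The minimum keeps \<open>Y'\<close> inside the set of words at every sample point.\<close>
  define Y' where "Y' \<omega> = g (Y \<omega>) (min (W n \<omega>) (R n - 1))" for \<omega>
  have Yn: "Y \<in> measurable (completed M (\<G> n)) (count_space (words A (len ?p)))"
    using measurable_completed_\<G>_mono[OF Y] n by simp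
  have g: "g x (min i (R n - 1)) \<in> words A (len (\<phi> n))" if "x \<in> words A (len ?p)" for x i
  proof -
    have "min i (R n - 1) \<in> \<pi> n x ` {..<R n}"
      using bij_betw_imp_surj_on[OF \<pi>_bij[OF n that]] R_pos[OF n] by simp
    then have "inv_into {..<R n} (\<pi> n x) (min i (R n - 1)) < R n"
      using inv_into_into[of "min i (R n - 1)" "\<pi> n x" "{..<R n}"] by simp
    then show ?thesis
      using that unfolding g_def len_eq_R[OF n] by (intro block_in_words)
  qed
  have "Y' \<in> measurable (completed M (\<G> n)) (count_space (words A (len (\<phi> n))))"
    unfolding Y'_def
  proof (rule measurable_compose_countable'[OF _ Yn countable_finite[OF finite_words[OF finite_A]]])
    fix x assume "x \<in> words A (len ?p)"
    then show "(\<lambda>\<omega>. g x (min (W n \<omega>) (R n - 1))) \<in>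
        measurable (completed M (\<G> n)) (count_space (words A (len (\<phi> n))))"
      using g by (intro measurable_compose[OF W_measurable_\<G>[OF n]]) auto
  qed
  moreover have "prob {\<omega>\<in>space M. Y' \<omega> \<noteq> X (\<phi> n) \<omega>} \<le> prob {\<omega>\<in>space M. Y \<omega> \<noteq> X ?p \<omega>}"
  proof (rule finite_measure_mono_AE)
    show "{\<omega>\<in>space M. Y \<omega> \<noteq> X ?p \<omega>} \<in> events"
      using n by (intro neq_event p measurable_completedD[OF \<G>_events Y]) auto
    show "AE \<omega> in M. \<omega> \<in> {\<omega>\<in>space M. Y' \<omega> \<noteq> X (\<phi> n) \<omega>} \<longrightarrow> \<omega> \<in> {\<omega>\<in>space M. Y \<omega> \<noteq> X ?p \<omega>}"
      using X_eq_block_U[OF n] AE_space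
    proof eventually_elim
      case (elim \<omega>)
      have "min (W n \<omega>) (R n - 1) = W n \<omega>"
        using W_less[OF n elim(2)] by simp
      then have "Y' \<omega> = X (\<phi> n) \<omega>" if "Y \<omega> = X ?p \<omega>"
        using U_from_W[OF n elim(2)] elim(1) that by (simp add: Y'_def g_def)
      then show ?case using elim(2) by auto
    qed
  qed
  ultimately show ?thesis
    using err unfolding approximable_def by (meson order_trans)
qed

lemma approximable_mono:
  assumes "approximable m \<epsilon>" "m \<le> n" "n \<le> 0"
  shows "approximable n \<epsilon>"
  using assms(2,3)
proof (induction n rule: int_ge_induct)
  case base
  then show ?case using assms(1) by simp
next
  case (step i)
  then show ?case using approximable_step[of "i + 1" \<epsilon>] by simp
qed

lemma X_measurable_\<G>:
  assumes n: "n \<le> 0" and approx: "\<And>\<epsilon>. \<epsilon> > 0 \<Longrightarrow> approximable n \<epsilon>"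
  shows "X (\<phi> n) \<in> measurable (completed M (\<G> n)) (count_space (words A (len (\<phi> n))))"
  unfolding measurable_count_space_eq2[OF finite_words[OF finite_A]]
proof (intro conjI ballI)
  show "X (\<phi> n) \<in> space (completed M (\<G> n)) \<rightarrow> words A (len (\<phi> n))"
    using X_words[OF \<phi>_nonpos[OF n]] by simp
  fix x assume x: "x \<in> words A (len (\<phi> n))"
  have D: "X (\<phi> n) -` {x} \<inter> space M \<in> events"
    using measurable_sets[OF X_measurable[OF \<phi>_nonpos[OF n]], of "{x}"] x by simp
  have "X (\<phi> n) -` {x} \<inter> space M \<in> sets (completed M (\<G> n))"
  proof (rule completed_limit[OF \<G>_events[OF n] D])
    fix \<epsilon> :: real assume \<epsilon>: "\<epsilon> > 0"
    obtain Y where Y: "Y \<in> measurable (completed M (\<G> n)) (count_space (words A (len (\<phi> n))))"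
        and err: "prob {\<omega>\<in>space M. Y \<omega> \<noteq> X (\<phi> n) \<omega>} \<le> \<epsilon> / 2"
      using approx[OF half_gt_zero[OF \<epsilon>]] unfolding approximable_def by blast
    let ?E = "Y -` {x} \<inter> space M"
    have E: "?E \<in> sets (completed M (\<G> n))" using measurable_sets[OF Y, of "{x}"] x by simp
    have "prob (sym_diff ?E (X (\<phi> n) -` {x} \<inter> space M)) \<le> prob {\<omega>\<in>space M. Y \<omega> \<noteq> X (\<phi> n) \<omega>}"
      by (intro finite_measure_mono neq_event[OF \<phi>_nonpos[OF n]]
          measurable_completedD[OF \<G>_events[OF n] Y]) auto
    then show "\<exists>E\<in>sets (completed M (\<G> n)). prob (sym_diff E (X (\<phi> n) -` {x} \<inter> space M)) < \<epsilon>"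
      using E err \<epsilon> by (intro bexI[OF _ E]) auto
  qed
  then show "X (\<phi> n) -` {x} \<inter> space (completed M (\<G> n)) \<in> sets (completed M (\<G> n))" by simp
qed

text \<open>Once the extracted words are known, each \<open>U m\<close> can be read off \<open>W m\<close>; the digits \<open>V j\<close> are
  encoded in \<open>U m\<close>, and the intermediate words are blocks of the extracted ones.\<close>
lemma F_subset_\<G>:
  assumes n: "n \<le> 0" and approx: "\<And>n \<epsilon>. n \<le> 0 \<Longrightarrow> \<epsilon> > 0 \<Longrightarrow> approximable n \<epsilon>"
  shows "F (\<phi> n) \<subseteq> sets (completed M (\<G> n))"
proof -
  have XG: "X (\<phi> (m - 1)) \<in> measurable (completed M (\<G> n)) (count_space (words A (len (\<phi> (m - 1)))))"
    if "m \<le> n" for m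
    using that n by (intro measurable_completed_\<G>_mono[OF X_measurable_\<G>] approx) auto
  have UG: "U m \<in> measurable (completed M (\<G> n)) (count_space UNIV)" if m: "m \<le> n" for m
  proof -
    have "(\<lambda>\<omega>. inv_into {..<R m} (\<pi> m (X (\<phi> (m - 1)) \<omega>)) (W m \<omega>)) \<in>
        measurable (completed M (\<G> n)) (count_space UNIV)"
      by (rule measurable_compose_countable'[OF _ XG[OF m] countable_finite[OF finite_words[OF finite_A]]],
        rule measurable_compose[OF measurable_completed_\<G>_mono[OF W_measurable_\<G>]]) (use m n in auto)
    then show ?thesis
      by (rule measurable_cong[THEN iffD1, rotated]) (use U_from_W[of m] m n in simp)
  qed
  have VG: "V j \<in> measurable (completed M (\<G> n)) (count_space {1..r j})" if j: "j \<le> \<phi> n" for j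
  proof -
    obtain m where m: "m \<le> n" "\<phi> (m - 1) < j" "j \<le> \<phi> m" using level_between[OF n j] by blast
    have m0: "m \<le> 0" using m n by simp
    obtain g where g: "\<And>\<omega>. \<omega> \<in> space M \<Longrightarrow> V j \<omega> = g (U m \<omega>)"
      using V_from_pos[of "\<phi> (m - 1)" "nat (\<phi> m - \<phi> (m - 1))"] m \<phi>_step[OF m0] \<phi>_nonpos[OF m0]
      unfolding U_def by (metis greaterThanAtMost_iff)
    have Vj: "V j \<omega> \<in> {1..r j}" if "\<omega> \<in> space M" for \<omega>
      using V_bounds[of j \<omega>] that m \<phi>_nonpos[OF m0] by auto
    show ?thesis
      unfolding measurable_count_space_eq2[OF finite_atLeastAtMost]
    proof (intro conjI ballI)
      show "V j \<in> space (completed M (\<G> n)) \<rightarrow> {1..r j}" using Vj by simp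
      fix v
      have "V j -` {v} \<inter> space M = U m -` (g -` {v}) \<inter> space M" using g by auto
      then show "V j -` {v} \<inter> space (completed M (\<G> n)) \<in> sets (completed M (\<G> n))"
        using measurable_sets[OF UG[OF m(1)], of "g -` {v}"] by simp
    qed
  qed
  have "X j \<in> measurable (completed M (\<G> n)) (count_space (words A (len j)))" if j: "j \<le> \<phi> n" for j
  proof -
    obtain m where m: "m \<le> n" "\<phi> (m - 1) < j" "j \<le> \<phi> m" using level_between[OF n j] by blast
    let ?p = "\<phi> (m - 1)"
    define k where "k = nat (j - ?p)"
    have k: "?p + int k = j" "j \<le> 0" using m n j \<phi>_nonpos[OF n] by (auto simp: k_def)
    have pos: "pos ?p k \<in> measurable (completed M (\<G> n)) (count_space UNIV)"
      by (rule pos_measurable, rule measurable_count_space_UNIV[OF VG]) (use k j in auto)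
    have "0 < len ?p div len j"
      using len_dvd[of ?p k] k len_pos[of ?p] m(2) len_pos[of j] by (auto intro: dvd_imp_le simp: div_greater_zero_iff)
    \<comment> \<open>Truncation at \<open>c\<close> makes the block a word of length \<open>len j\<close> for every natural number.\<close>
    define c where "c = len ?p div len j - 1"
    let ?Y = "\<lambda>\<omega>. block (len j) (min (pos ?p k \<omega>) c) (X ?p \<omega>)"
    have len: "len ?p = Suc c * len j"
      using len_dvd[of ?p k] k \<open>0 < len ?p div len j\<close> by (simp add: c_def)
    have Y: "?Y \<in> measurable (completed M (\<G> n)) (count_space (words A (len j)))"
    proof (rule measurable_compose_countable'[OF _ XG[OF m(1)] countable_finite[OF finite_words[OF finite_A]]])
      fix x assume "x \<in> words A (len ?p)"
      then have "block (len j) (min i c) x \<in> words A (len j)" for i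
        unfolding len by (rule block_in_words) simp
      then show "(\<lambda>\<omega>. block (len j) (min (pos ?p k \<omega>) c) x) \<in>
          measurable (completed M (\<G> n)) (count_space (words A (len j)))"
        by (intro measurable_compose[OF pos]) auto
    qed
    have eq: "AE \<omega> in M. X j \<omega> = ?Y \<omega>"
      using X_eq_block_pos[of ?p k, unfolded k(1), OF k(2)] AE_space
    proof eventually_elim
      case (elim \<omega>)
      have "min (pos ?p k \<omega>) c = pos ?p k \<omega>"
        using pos_less[of ?p k \<omega>] k elim(2) by (simp add: c_def)
      then show ?case using elim(1) by simp
    qed
    show ?thesis
      by (rule measurable_completed_AE_cong[OF \<G>_events[OF n] finite_words[OF finite_A] Y
          X_measurable[OF k(2)] eq])
  qed
  then show ?thesis
    unfolding split_word_filtration_def natural_filtration_def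
    by (intro sigma_field_of_least) (auto simp: split_word_space_def simp del: One_nat_def intro!: measurable_Pair VG)
qed

lemma product_type_if_approximable:
  assumes "\<And>n \<epsilon>. n \<le> 0 \<Longrightarrow> \<epsilon> > 0 \<Longrightarrow> approximable n \<epsilon>"
  shows "product_type M (\<lambda>n. F (\<phi> n))"
proof (rule product_typeI[OF W_indep])
  fix n :: int assume n: "n \<le> 0"
  have "sets (completed M (F (\<phi> n))) = sets (completed M (\<G> n))"
    using n \<phi>_nonpos[OF n]
    by (intro equalityI completed_subset F_events \<G>_events F_subset_\<G> \<G>_subset_F assms) auto
  then show "eq_mod_null M (F (\<phi> n)) (natural_filtration M (\<lambda>_. count_space UNIV) W n)"
    unfolding \<G>_def[symmetric]
    using eq_mod_null_iff_completed[OF F_events \<G>_events, of "\<phi> n" n] n \<phi>_nonpos[OF n] by simp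
qed

end

lemma (in extracted_split_word_process) product_type_if_ratios_large:
  assumes good: "\<And>m c. m \<le> 0 \<Longrightarrow> \<exists>n\<le>m. c * K n \<le> real (R n)"
  shows "product_type M (\<lambda>n. F (\<phi> n))"
proof -
  obtain f \<pi> where f: "\<And>n. n \<le> 0 \<Longrightarrow> relabelling n (f n) (\<pi> n)"
    using exists_relabelling by metis
  interpret relabelled_split_word_process M A len X V \<phi> f \<pi>
    by unfold_locales (rule f)
  show ?thesis
  proof (rule product_type_if_approximable)
    fix n :: int and \<epsilon> :: real assume n: "n \<le> 0" and \<epsilon>: "\<epsilon> > 0"
    define t where "t = max 1 (2 / \<epsilon>)"
    obtain m where m: "m \<le> n" "t\<^sup>2 * K m \<le> R m" using good[OF n] by blast
    have "approximable m (2 / t)"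
      by (rule approximable_start) (use m n in \<open>auto simp: t_def\<close>)
    then have "approximable n (2 / t)" by (rule approximable_mono) (use m n in auto)
    moreover have "2 / t \<le> \<epsilon>" using \<epsilon> by (simp add: t_def max_def field_simps)
    ultimately show "approximable n \<epsilon>" unfolding approximable_def by (meson order_trans)
  qed
qed

section \<open>Lengths that grow like an iterated exponential\<close>

text \<open>The lengths are \<open>len (- k) = 4 ^ tower k\<close>.\<close>
primrec tower :: "nat \<Rightarrow> nat" where
  "tower 0 = 0"
| "tower (Suc k) = 2 ^ tower k"

lemma tower_ge: "k \<le> tower k"
proof (induction k)
  case (Suc k)
  then have "k < 2 ^ tower k" using less_exp by (rule le_less_trans)
  then show ?case by simp
qed simp

lemma tower_mono: "i \<le> k \<Longrightarrow> tower i \<le> tower k"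
proof (rule lift_Suc_mono_le[of tower])
  show "tower n \<le> tower (Suc n)" for n using less_exp[of "tower n"] by simp
qed

lemma len_eq_tower:
  fixes len :: "int \<Rightarrow> nat"
  assumes l0: "len 0 = 1"
    and rec: "\<And>n. n \<le> 0 \<Longrightarrow> real (len (n - 1)) = 4 powr sqrt (real (len n))"
  shows "len (- int k) = 4 ^ tower k"
proof (induction k)
  case 0
  then show ?case using l0 by simp
next
  case (Suc k)
  have "(4::real) ^ tower k = (2\<^sup>2) ^ tower k" by simp
  also have "\<dots> = (2 ^ tower k)\<^sup>2" by (simp only: power_mult[symmetric] mult.commute)
  finally have "sqrt (real (len (- int k))) = real (2 ^ tower k)"
    using Suc.IH by simp
  then have "real (len (- int k - 1)) = 4 powr real (2 ^ tower k)"
    using rec[of "- int k"] by simp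
  also have "\<dots> = real (4 ^ (2 ^ tower k))"
    by (subst powr_realpow) simp_all
  finally have "len (- int k - 1) = 4 ^ (2 ^ tower k)"
    by (simp only: of_nat_eq_iff)
  moreover have "- int k - 1 = - int (Suc k)" by simp
  ultimately show ?case by simp
qed

lemma double_exponential_growth:
  fixes N C j :: nat
  assumes "N + C + 5 \<le> j"
  shows "N * 4 ^ j + C + j \<le> 2 ^ 2 ^ j"
proof -
  have "3 * i \<le> 2 ^ i" if "4 \<le> i" for i :: nat
    using that by (induction i rule: dec_induct) auto
  then have j3: "3 * j \<le> 2 ^ j" using assms by simp
  have "1 \<le> (4::nat) ^ j" "j \<le> 4 ^ j"
    using less_exp[of j] power_mono[of 2 "4::nat" j] by auto
  then have "C + j \<le> C * 4 ^ j + 4 ^ j" by (intro add_mono) simp_all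
  then have "N * 4 ^ j + C + j \<le> (N + C + 1) * 4 ^ j"
    by (simp add: add_mult_distrib)
  also have "\<dots> \<le> 2 ^ j * 4 ^ j"
    using assms less_exp[of j] by (intro mult_le_mono1) linarith
  also have "\<dots> = 2 ^ (3 * j)"
    by (simp add: power_mult power_mult_distrib[symmetric])
  also have "\<dots> \<le> 2 ^ 2 ^ j"
    using j3 by (intro power_increasing) auto
  finally show ?thesis .
qed

text \<open>Without jumps of size at least 2, the difference \<open>\<phi> n - n\<close> would eventually be constant.\<close>
lemma infinitely_many_jumps:
  fixes \<phi> :: "int \<Rightarrow> int"
  assumes less: "\<And>n. n \<le> 0 \<Longrightarrow> \<phi> (n - 1) < \<phi> n"
    and lim: "filterlim (\<lambda>n. \<phi> n - n) at_bot at_bot" and m: "m \<le> 0"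
  shows "\<exists>n\<le>m. \<phi> (n - 1) \<le> \<phi> n - 2"
proof (rule ccontr)
  assume no: "\<not> ?thesis"
  have step: "\<phi> (n - 1) = \<phi> n - 1" if "n \<le> m" for n
    using no that less[of n] m by force
  have const: "\<phi> n - n = \<phi> m - m" if "n \<le> m" for n
    using that
  proof (induction n rule: int_le_induct)
    case (step i)
    then show ?case using \<open>\<And>n. n \<le> m \<Longrightarrow> \<phi> (n - 1) = \<phi> n - 1\<close>[of i] by simp
  qed simp
  have "eventually (\<lambda>n. \<phi> n - n \<le> \<phi> m - m - 1) at_bot"
    using lim unfolding filterlim_at_bot by blast
  then obtain b where "\<And>n. n \<le> b \<Longrightarrow> \<phi> n - n \<le> \<phi> m - m - 1"
    unfolding eventually_at_bot_linorder by blast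
  from this[of "min b m"] const[of "min b m"] show False by simp
qed

locale tower_split_word_process = finite_split_word_process +
  assumes len_tower: "\<And>k. len (- int k) = 4 ^ tower k"
begin

text \<open>With \<open>j = tower (nat (- n))\<close>, the number of words of length \<open>len n = 4 ^ j\<close> is exponential in
  \<open>4 ^ j\<close>. After a jump, the number of blocks is exponential in \<open>2 ^ 2 ^ j\<close>, which is larger by
  far.\<close>
lemma jump_ratio:
  fixes c :: real
  assumes p: "p \<le> n - 2" "n \<le> 0" and C: "c \<le> 4 ^ C"
    and n: "card A + C + 5 \<le> tower (nat (- n))"
  shows "c * real (card A ^ len n) \<le> real (len p div len n)"
proof -
  define j where "j = tower (nat (- n))"
  have ln: "len n = 4 ^ j" using len_tower[of "nat (- n)"] p(2) by (simp add: j_def)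
  have lp: "len p = 4 ^ tower (nat (- p))" using len_tower[of "nat (- p)"] p by simp
  have "nat (- n + 2) = Suc (Suc (nat (- n)))" using p(2) by simp
  then have "2 ^ 2 ^ j = tower (nat (- n + 2))" by (simp add: j_def)
  also have "\<dots> \<le> tower (nat (- p))" using p by (intro tower_mono) simp
  finally have "card A * 4 ^ j + C + j \<le> tower (nat (- p))"
    using double_exponential_growth[of "card A" C j] n by (simp add: j_def)
  then have "(4::nat) ^ (card A * 4 ^ j + C + j) \<le> len p"
    unfolding lp by (intro power_increasing) auto
  then have "4 ^ (card A * 4 ^ j + C) * len n \<le> len p"
    by (simp add: ln power_add)
  then have "4 ^ (card A * 4 ^ j + C) \<le> len p div len n"
    using div_le_mono[of _ "len p" "len n"] len_pos[OF p(2)] by fastforce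
  moreover have "card A ^ len n \<le> 4 ^ (card A * 4 ^ j)"
  proof -
    have "card A \<le> 4 ^ card A"
      using less_exp[of "card A"] power_mono[of 2 "4::nat" "card A"] by simp
    then have "card A ^ len n \<le> (4 ^ card A) ^ len n" by (rule power_mono) simp
    then show ?thesis by (simp add: ln power_mult)
  qed
  then have "c * real (card A ^ len n) \<le> 4 ^ C * real (4 ^ (card A * 4 ^ j))"
    using C by (intro mult_mono) (simp_all flip: of_nat_power del: of_nat_power)
  ultimately show ?thesis
    by (simp add: power_add mult.commute flip: of_nat_le_iff[where 'a = real])
qed

lemma product_type_jumping:
  fixes \<phi> :: "int \<Rightarrow> int"
  assumes \<phi>: "\<phi> ` {..0} \<subseteq> {..0}" "strict_mono_on {..0} \<phi>" "filterlim (\<lambda>n. \<phi> n - n) at_bot at_bot"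
  shows "product_type M (\<lambda>n. F (\<phi> n))"
proof -
  have less: "\<phi> (n - 1) < \<phi> n" if "n \<le> 0" for n
    using \<phi>(2) that by (auto simp: strict_mono_on_def)
  interpret extracted_split_word_process M A len X V \<phi>
    by unfold_locales (use \<phi>(1) less in auto)
  show ?thesis
  proof (rule product_type_if_ratios_large)
    fix m :: int and c :: real assume m: "m \<le> 0"
    obtain C where C: "c \<le> 4 ^ C" using real_arch_pow[of 4 c] by (auto intro: less_imp_le)
    define J where "J = card A + C + 5"
    obtain n where n: "n \<le> min m (- int J)" "\<phi> (n - 1) \<le> \<phi> n - 2"
      using infinitely_many_jumps[OF less \<phi>(3) min.coboundedI1[OF m, of "- int J"]] by blast
    have n0: "n \<le> 0" using n m by simp
    have "J \<le> nat (- \<phi> n)" using \<phi>_le[OF n0] n(1) by linarith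
    also have "\<dots> \<le> tower (nat (- \<phi> n))" by (rule tower_ge)
    finally have "c * real (card A ^ len (\<phi> n)) \<le> real (len (\<phi> (n - 1)) div len (\<phi> n))"
      unfolding J_def using n(2) \<phi>_nonpos[OF n0] C by (intro jump_ratio)
    then show "\<exists>n\<le>m. c * K n \<le> real (R n)"
      using n by (intro exI[of _ n]) (simp add: K_def R_def card_words finite_A)
  qed
qed

end

section \<open>The cost of fitting a labelled tree to a word\<close>

text \<open>Level \<open>j\<close> lies \<open>j\<close> steps before the time at which a word is predicted. The history \<open>w\<close> of labels
  grows by an element of \<open>L j\<close> at each step, and \<open>h\<close> predicts the final word from the whole history.
  The cost is the mean prediction error if the block numbers are uniform and each label may be
  chosen optimally after the block. It hence bounds from below the error of any predictor that
  uses labels in the sets \<open>L j\<close>, whatever their joint law with the process. It can be seen as a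
  simplification of Vershik's distance between the tree of a word and a fixed labelled tree:
  the minimum is taken for each block separately instead of over all couplings.\<close>
primrec cost :: "(nat \<Rightarrow> nat) \<Rightarrow> (nat \<Rightarrow> nat) \<Rightarrow> (nat \<Rightarrow> 'b set set) \<Rightarrow> ('b set \<Rightarrow> 'a list) \<Rightarrow>
    nat \<Rightarrow> 'a list \<Rightarrow> 'b set \<Rightarrow> real" where
  "cost l r L h 0 x w = of_bool (h w \<noteq> x)"
| "cost l r L h (Suc j) x w =
    (\<Sum>v<r j. Min ((\<lambda>a. cost l r L h j (block (l j) v x) (w \<union> a)) ` L j)) / r j"

text \<open>The minimum over labels is bounded by a sum, which turns the exponential of the cost of a word into
  a product over its blocks, of which the sum over all words is a power. So passing from level
  \<open>j\<close> to level \<open>j + 1\<close> costs a factor \<open>card (L j) \<le> r j\<close> for each of the \<open>r j\<close> blocks, whence the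
  recursion for \<open>s\<close>, which is the binary logarithm of the moment, per letter. The weight
  \<open>card A powr (- l * cost)\<close> is normalised such that at level 0 all wrong words together weigh no
  more than the right one.\<close>
lemma cost_moment:
  fixes A :: "'a set" and s :: "nat \<Rightarrow> real"
  assumes A: "finite A" "2 \<le> card A"
    and l: "\<And>j. 0 < l j" "\<And>j. l (Suc j) = r j * l j"
    and L: "\<And>j. finite (L j)" "\<And>j. L j \<noteq> {}" "\<And>j. card (L j) \<le> r j"
    and s: "1 / l 0 \<le> s 0" "\<And>j. s j + log 2 (r j) / l j \<le> s (Suc j)"
  shows "(\<Sum>x\<in>words A (l j). card A powr (- (l j * cost l r L h j x w))) \<le> 2 powr (l j * s j)"
proof (induction j arbitrary: w)
  case 0
  have A_ne: "A \<noteq> {}" using A by auto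
  let ?N = "real (card A)"
  have "?N powr (- (l 0 * cost l r L h 0 x w)) \<le> of_bool (x = h w) + ?N powr (- l 0)" for x
    by (cases "x = h w") auto
  then have "(\<Sum>x\<in>words A (l 0). ?N powr (- (l 0 * cost l r L h 0 x w))) \<le>
      (\<Sum>x\<in>words A (l 0). of_bool (x = h w) + ?N powr (- l 0))"
    by (intro sum_mono)
  also have "\<dots> \<le> 1 + card (words A (l 0)) * ?N powr (- l 0)"
    using finite_words[OF A(1), of "l 0"] by (auto simp: sum.distrib of_bool_def sum.delta')
  also have "\<dots> = 2"
    using A A_ne by (simp add: card_words powr_minus powr_realpow)
  also have "2 = 2 powr (l 0 * (1 / l 0))" using l(1)[of 0] by simp
  also have "\<dots> \<le> 2 powr (l 0 * s 0)"
    using s(1) by (intro powr_mono mult_left_mono) auto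
  finally show ?case by simp
next
  case (Suc j)
  let ?N = "real (card A)"
  define m where "m y = Min ((\<lambda>a. cost l r L h j y (w \<union> a)) ` L j)" for y
  define G where "G y = (\<Sum>a\<in>L j. ?N powr (- (l j * cost l r L h j y (w \<union> a))))" for y
  have r: "0 < r j" using l(1)[of "Suc j"] l(2)[of j] by (cases "r j") auto
  have N: "0 < ?N" using A by simp
  have mG: "?N powr (- (l j * m y)) \<le> G y" for y
  proof -
    have "m y \<in> (\<lambda>a. cost l r L h j y (w \<union> a)) ` L j"
      unfolding m_def using L by (intro Min_in) auto
    then obtain a where a: "a \<in> L j" "m y = cost l r L h j y (w \<union> a)" by auto
    show ?thesis
      unfolding G_def a(2) using L(1) a(1)
      by (intro member_le_sum[of a "L j" "\<lambda>a. ?N powr (- (l j * cost l r L h j y (w \<union> a)))"]) auto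
  qed
  have "?N powr (- (l (Suc j) * cost l r L h (Suc j) x w)) \<le> (\<Prod>v<r j. G (block (l j) v x))" for x
  proof -
    have "cost l r L h (Suc j) x w = (\<Sum>v<r j. m (block (l j) v x)) / r j"
      by (simp add: m_def)
    then have "l (Suc j) * cost l r L h (Suc j) x w = l j * (\<Sum>v<r j. m (block (l j) v x))"
      using r by (simp add: l(2) del: cost.simps)
    then have "- (l (Suc j) * cost l r L h (Suc j) x w) = (\<Sum>v<r j. - (l j * m (block (l j) v x)))"
      by (simp add: sum_negf sum_distrib_left del: cost.simps)
    then have "?N powr (- (l (Suc j) * cost l r L h (Suc j) x w)) =
        (\<Prod>v<r j. ?N powr (- (l j * m (block (l j) v x))))"
      using N by (simp add: powr_sum del: cost.simps)
    also have "\<dots> \<le> (\<Prod>v<r j. G (block (l j) v x))"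
      by (intro prod_mono) (auto intro: mG)
    finally show ?thesis .
  qed
  then have "(\<Sum>x\<in>words A (l (Suc j)). ?N powr (- (l (Suc j) * cost l r L h (Suc j) x w))) \<le>
      (\<Sum>x\<in>words A (r j * l j). \<Prod>v<r j. G (block (l j) v x))"
    unfolding l(2)[of j, symmetric] by (intro sum_mono)
  also have "\<dots> = (\<Sum>y\<in>words A (l j). G y) ^ r j"
    by (rule sum_words_prod_blocks)
  also have "\<dots> \<le> (r j * 2 powr (l j * s j)) ^ r j"
  proof (rule power_mono)
    have "(\<Sum>y\<in>words A (l j). G y) =
        (\<Sum>a\<in>L j. \<Sum>y\<in>words A (l j). ?N powr (- (l j * cost l r L h j y (w \<union> a))))"
      unfolding G_def by (rule sum.swap)
    also have "\<dots> \<le> (\<Sum>a\<in>L j. 2 powr (l j * s j))"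
      by (intro sum_mono Suc.IH)
    also have "\<dots> \<le> r j * 2 powr (l j * s j)"
      using L(3)[of j] by (simp add: mult_right_mono)
    finally show "(\<Sum>y\<in>words A (l j). G y) \<le> r j * 2 powr (l j * s j)" .
    show "0 \<le> (\<Sum>y\<in>words A (l j). G y)"
      by (intro sum_nonneg) (auto simp: G_def intro!: sum_nonneg)
  qed
  also have "r j * 2 powr (l j * s j) = 2 powr (log 2 (r j) + l j * s j)"
    using r by (simp add: powr_add)
  also have "\<dots> ^ r j = 2 powr (real (l (Suc j)) * (s j + log 2 (r j) / l j))"
  proof -
    have "real (l (Suc j)) * (s j + log 2 (r j) / l j) = (log 2 (r j) + l j * s j) * r j"
      using l(1)[of j] by (simp add: l(2) distrib_left distrib_right)
    then show ?thesis by (simp add: powr_realpow[symmetric] powr_powr)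
  qed
  also have "\<dots> \<le> 2 powr (l (Suc j) * s (Suc j))"
    using s(2)[of j] by (intro powr_mono mult_left_mono) auto
  finally show ?case .
qed

text \<open>By convexity of the exponential, a mean cost below \<open>1 / 2\<close> would make the sum in \<open>cost_moment\<close>
  larger than \<open>card A powr (l / 2)\<close>.\<close>
lemma cost_mean:
  fixes A :: "'a set" and s :: "nat \<Rightarrow> real"
  assumes A: "finite A" "2 \<le> card A"
    and l: "\<And>j. 0 < l j" "\<And>j. l (Suc j) = r j * l j"
    and L: "\<And>j. finite (L j)" "\<And>j. L j \<noteq> {}" "\<And>j. card (L j) \<le> r j"
    and s: "1 / l 0 \<le> s 0" "\<And>j. s j + log 2 (r j) / l j \<le> s (Suc j)" and s_half: "s j \<le> 1 / 2"
  shows "1 / 2 \<le> (\<Sum>x\<in>words A (l j). cost l r L h j x w) / card A ^ l j"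
proof (rule ccontr)
  define N where "N = real (card A)"
  define k where "k = real (l j)"
  define z where "z x = cost l r L h j x w" for x
  have N: "2 \<le> N" using A by (simp add: N_def)
  have k: "0 < k" using l(1) by (simp add: k_def)
  have cW: "real (card (words A (l j))) = N powr k"
    using N by (simp add: card_words A N_def[symmetric] k_def powr_realpow)
  have sq: "N powr k = N powr (k / 2) * N powr (k / 2)"
    by (simp add: powr_add[symmetric])
  assume "\<not> ?thesis"
  then have small: "(\<Sum>x\<in>words A (l j). z x) < N powr k / 2"
    using N by (simp add: z_def N_def[symmetric] k_def powr_realpow field_simps)
  have tangent: "N powr (- (k / 2)) * (1 + k * ln N / 2 - k * ln N * z x) \<le> N powr (- (k * z x))" for x
  proof -
    have "1 + (k * ln N / 2 - k * ln N * z x) \<le> exp (k * ln N / 2 - k * ln N * z x)"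
      by (rule exp_ge_add_one_self)
    also have "\<dots> = N powr (k / 2) * N powr (- (k * z x))"
      using N by (simp add: powr_def exp_add[symmetric] algebra_simps)
    finally have "N powr (- (k / 2)) * (1 + k * ln N / 2 - k * ln N * z x) \<le>
        N powr (- (k / 2)) * (N powr (k / 2) * N powr (- (k * z x)))"
      by (intro mult_left_mono) auto
    also have "\<dots> = N powr (- (k * z x))"
      using N by (simp add: powr_minus)
    finally show ?thesis .
  qed
  have "N powr (k / 2) = N powr (- (k / 2)) * N powr k"
    using N by (simp add: powr_add[symmetric])
  also have "\<dots> < N powr (- (k / 2)) * (N powr k * (1 + k * ln N / 2) - k * ln N * (\<Sum>x\<in>words A (l j). z x))"
    using small N k by (intro mult_strict_left_mono) (auto simp: algebra_simps)
  also have "\<dots> = (\<Sum>x\<in>words A (l j). N powr (- (k / 2)) * (1 + k * ln N / 2 - k * ln N * z x))"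
    by (simp only: sum_distrib_left[symmetric] sum_subtractf sum_constant cW)
  also have "\<dots> \<le> (\<Sum>x\<in>words A (l j). N powr (- (k * z x)))"
    by (intro sum_mono tangent)
  also have "\<dots> \<le> 2 powr (k * s j)"
    unfolding N_def k_def z_def by (rule cost_moment[OF A l L s])
  also have "\<dots> \<le> 2 powr (k / 2)"
    using s_half k by (intro powr_mono) auto
  also have "\<dots> \<le> N powr (k / 2)"
    using N k by (intro powr_mono2) auto
  finally show False by simp
qed

section \<open>Innovations of a split-word process take few values\<close>
lemma measurable_Pair_count_space:
  assumes f: "f \<in> measurable N (count_space I)" and g: "g \<in> measurable N (count_space J)"
    and fin: "finite I" "finite J"
  shows "(\<lambda>\<omega>. (f \<omega>, g \<omega>)) \<in> measurable N (count_space (I \<times> J))"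
  unfolding measurable_count_space_eq2[OF finite_cartesian_product[OF fin]]
proof (intro conjI ballI)
  show "(\<lambda>\<omega>. (f \<omega>, g \<omega>)) \<in> space N \<rightarrow> I \<times> J"
    using measurable_space[OF f] measurable_space[OF g] by auto
  fix c assume c: "c \<in> I \<times> J"
  have "(\<lambda>\<omega>. (f \<omega>, g \<omega>)) -` {c} \<inter> space N = (f -` {fst c} \<inter> space N) \<inter> (g -` {snd c} \<inter> space N)"
    by (cases c) auto
  then show "(\<lambda>\<omega>. (f \<omega>, g \<omega>)) -` {c} \<inter> space N \<in> sets N"
    using measurable_sets[OF f, of "{fst c}"] measurable_sets[OF g, of "{snd c}"] c by auto
qed

lemma (in prob_space) integrable_finite_range:
  fixes g :: "'c \<Rightarrow> real"
  assumes Y: "Y \<in> measurable M (count_space I)" and I: "finite I"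
  shows "integrable M (\<lambda>\<omega>. g (Y \<omega>))"
proof (rule integrable_const_bound[where B = "\<Sum>y\<in>I. \<bar>g y\<bar>"])
  have "norm (g (Y \<omega>)) \<le> (\<Sum>y\<in>I. \<bar>g y\<bar>)" if "\<omega> \<in> space M" for \<omega>
    using measurable_space[OF Y that] member_le_sum[of "Y \<omega>" I "\<lambda>y. \<bar>g y\<bar>"] I by simp
  then show "AE \<omega> in M. norm (g (Y \<omega>)) \<le> (\<Sum>y\<in>I. \<bar>g y\<bar>)" by auto
  show "(\<lambda>\<omega>. g (Y \<omega>)) \<in> borel_measurable M"
    by (rule measurable_compose[OF Y]) simp
qed

context finite_split_word_process
begin

lemma expectation_V:
  fixes g :: "nat \<Rightarrow> 'c \<Rightarrow> real"
  assumes n: "n \<le> 0" and Y: "Y \<in> measurable (completed M (F (n - 1))) (count_space I)" and I: "finite I"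
  shows "expectation (\<lambda>\<omega>. g (V n \<omega>) (Y \<omega>)) = expectation (\<lambda>\<omega>. (\<Sum>v<r n. g (v + 1) (Y \<omega>)) / r n)"
proof -
  have YM: "Y \<in> measurable M (count_space I)"
    by (rule measurable_completedD[OF F_events Y]) (use n in simp)
  have VY: "(\<lambda>\<omega>. (V n \<omega>, Y \<omega>)) \<in> measurable M (count_space ({1..r n} \<times> I))"
    by (intro measurable_Pair_count_space V_measurable n YM I) simp
  have cell: "prob ((\<lambda>\<omega>. (V n \<omega>, Y \<omega>)) -` {(v, y)} \<inter> space M) = prob (Y -` {y} \<inter> space M) / r n"
    if "v \<in> {1..r n}" "y \<in> I" for v y
  proof -
    have "Y -` {y} \<inter> space M \<in> sets (completed M (F (n - 1)))"
      using measurable_sets[OF Y, of "{y}"] that by simp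
    from V_prob[OF n that(1) this] show ?thesis
      by (rule trans[rotated]) (rule arg_cong[where f = prob], auto)
  qed
  have "expectation (\<lambda>\<omega>. case_prod g (V n \<omega>, Y \<omega>)) =
      (\<Sum>c\<in>{1..r n} \<times> I. case_prod g c * prob ((\<lambda>\<omega>. (V n \<omega>, Y \<omega>)) -` {c} \<inter> space M))"
    by (rule expectation_finite_range[OF VY]) (use I in simp)
  also have "\<dots> = (\<Sum>v\<in>{1..r n}. \<Sum>y\<in>I. g v y * (prob (Y -` {y} \<inter> space M) / r n))"
    unfolding sum.cartesian_product by (rule sum.cong) (use cell in auto)
  also have "\<dots> = (\<Sum>y\<in>I. \<Sum>v\<in>{1..r n}. g v y * (prob (Y -` {y} \<inter> space M) / r n))"
    by (rule sum.swap)
  also have "\<dots> = (\<Sum>y\<in>I. (\<Sum>v<r n. g (v + 1) y) / r n * prob (Y -` {y} \<inter> space M))"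
  proof (rule sum.cong[OF refl])
    fix y
    have "(\<Sum>v\<in>{1..r n}. g v y) = (\<Sum>v<r n. g (v + 1) y)"
      by (rule sum.reindex_bij_witness[of _ "\<lambda>v. v + 1" "\<lambda>v. v - 1"]) auto
    then show "(\<Sum>v\<in>{1..r n}. g v y * (prob (Y -` {y} \<inter> space M) / r n)) =
        (\<Sum>v<r n. g (v + 1) y) / r n * prob (Y -` {y} \<inter> space M)"
      by (simp add: sum_distrib_right[symmetric] sum_divide_distrib[symmetric])
  qed
  also have "\<dots> = expectation (\<lambda>\<omega>. (\<Sum>v<r n. g (v + 1) (Y \<omega>)) / r n)"
    by (rule expectation_finite_range[OF YM I, symmetric])
  finally show ?thesis by simp
qed

text \<open>On the event that \<open>V n = v\<close>, the present adds nothing to the past: there \<open>X n\<close> is the \<open>v\<close>-th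
  subword of \<open>X (n - 1)\<close>.\<close>
lemma F_trace_on_V:
  assumes n: "n \<le> 0" and E: "E \<in> F n"
  shows "\<exists>G\<in>F (n - 1). AE \<omega> in M. V n \<omega> = v \<longrightarrow> (\<omega> \<in> E \<longleftrightarrow> \<omega> \<in> G)"
proof -
  interpret F: sigma_algebra "space M" "F (n - 1)" by (rule F_sigma_algebra)
  have "E \<in> sigma_sets (space M) (\<Union>m\<in>{..n}. {(\<lambda>\<omega>. (X m \<omega>, V m \<omega>)) -` B \<inter> space M |B.
      B \<in> sets (split_word_space A len m)})"
    using E unfolding split_word_filtration_def natural_filtration_def sigma_field_of_def .
  then show ?thesis
  proof induction
    case (Basic E)
    then obtain m B where m: "m \<le> n" and B: "B \<in> sets (split_word_space A len m)"
        and E: "E = (\<lambda>\<omega>. (X m \<omega>, V m \<omega>)) -` B \<inter> space M" by auto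
    show ?case
    proof (cases "m = n")
      case False
      then have "E \<in> F (n - 1)"
        unfolding E split_word_filtration_def natural_filtration_def
        by (intro sigma_field_of_basic[where Y = "\<lambda>m \<omega>. (X m \<omega>, V m \<omega>)"] B) (use m in auto)
      then show ?thesis by auto
    next
      case True
      let ?G = "{\<omega>\<in>space M. (subword (len n) v (X (n - 1) \<omega>), v) \<in> B}"
      have "?G \<in> F (n - 1)"
        by (rule F_event[of "n - 1" "n - 1" "\<lambda>x u. (subword (len n) v x, v) \<in> B"]) (use n in auto)
      moreover have "AE \<omega> in M. V n \<omega> = v \<longrightarrow> (\<omega> \<in> E \<longleftrightarrow> \<omega> \<in> ?G)"
        using X_split[OF n] AE_space by eventually_elim (auto simp: E True)
      ultimately show ?thesis by blast
    qed
  next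
    case Empty
    show ?case by (rule bexI[of _ "{}"]) auto
  next
    case (Compl E)
    then obtain G where G: "G \<in> F (n - 1)" "AE \<omega> in M. V n \<omega> = v \<longrightarrow> (\<omega> \<in> E \<longleftrightarrow> \<omega> \<in> G)" by blast
    have "AE \<omega> in M. V n \<omega> = v \<longrightarrow> (\<omega> \<in> space M - E \<longleftrightarrow> \<omega> \<in> space M - G)"
      using G(2) by eventually_elim auto
    then show ?case using G(1) by blast
  next
    case (Union E)
    then have "\<forall>i. \<exists>G. G \<in> F (n - 1) \<and> (AE \<omega> in M. V n \<omega> = v \<longrightarrow> (\<omega> \<in> E i \<longleftrightarrow> \<omega> \<in> G))" by blast
    then obtain G where G: "\<And>i. G i \<in> F (n - 1)"
        "\<And>i. AE \<omega> in M. V n \<omega> = v \<longrightarrow> (\<omega> \<in> E i \<longleftrightarrow> \<omega> \<in> G i)" by metis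
    have "AE \<omega> in M. \<forall>i. V n \<omega> = v \<longrightarrow> (\<omega> \<in> E i \<longleftrightarrow> \<omega> \<in> G i)"
      unfolding AE_all_countable using G(2) by blast
    then have "AE \<omega> in M. V n \<omega> = v \<longrightarrow> (\<omega> \<in> (\<Union>i. E i) \<longleftrightarrow> \<omega> \<in> (\<Union>i. G i))"
      by eventually_elim auto
    moreover have "(\<Union>i. G i) \<in> F (n - 1)" using G(1) by auto
    ultimately show ?case by blast
  qed
qed

text \<open>Choose \<open>v\<close> such that \<open>E\<close> meets the event that \<open>V n = v\<close> in a set of positive probability. There
  \<open>E\<close> coincides with a past event \<open>G\<close>, hence \<open>prob (E \<inter> G) \<ge> prob G / r n\<close>; by independence, the
  left-hand side is \<open>prob E * prob G\<close>.\<close>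
lemma innovation_atom:
  assumes n: "n \<le> 0" and E: "E \<in> sets (completed M (F n))"
    and indep: "\<And>G. G \<in> F (n - 1) \<Longrightarrow> prob (E \<inter> G) = prob E * prob G" and pos: "0 < prob E"
  shows "1 / r n \<le> prob E"
proof -
  have Eev: "E \<in> events" using E sets_completed_subset[OF F_events[OF n]] by auto
  obtain D where D: "D \<in> F n" "AE \<omega> in M. \<omega> \<in> E \<longleftrightarrow> \<omega> \<in> D"
    using completed_approx[OF F_sigma_algebra F_events[OF n] E] by blast
  have "\<forall>v. \<exists>G\<in>F (n - 1). AE \<omega> in M. V n \<omega> = v \<longrightarrow> (\<omega> \<in> D \<longleftrightarrow> \<omega> \<in> G)"
    using F_trace_on_V[OF n D(1)] by blast
  then obtain G where G: "\<And>v. G v \<in> F (n - 1)"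
      "\<And>v. AE \<omega> in M. V n \<omega> = v \<longrightarrow> (\<omega> \<in> D \<longleftrightarrow> \<omega> \<in> G v)" by metis
  have Gev: "G v \<in> events" for v using G(1) F_events[of "n - 1"] n by auto
  let ?V = "\<lambda>v. {\<omega>\<in>space M. V n \<omega> = v}"
  have Vev: "?V v \<in> events" for v
    using F_event[OF n order_refl, of "\<lambda>x u. u = v"] F_events[OF n] by auto
  have EG: "AE \<omega> in M. \<omega> \<in> E \<inter> ?V v \<longleftrightarrow> \<omega> \<in> ?V v \<inter> G v" for v
    using D(2) G(2)[of v] AE_space by eventually_elim auto
  have EV: "prob (E \<inter> ?V v) = prob (G v) / r n" if "v \<in> {1..r n}" for v
  proof -
    have "prob (E \<inter> ?V v) = prob (?V v \<inter> G v)"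
      using EG[of v] Eev Vev Gev by (intro finite_measure_eq_AE) auto
    also have "\<dots> = prob (G v) / r n"
      by (rule V_prob[OF n that completedI(1)[OF F_events G(1)]]) (use n in simp)
    finally show ?thesis .
  qed
  have "E = (\<Union>v\<in>{1..r n}. E \<inter> ?V v)"
    using V_bounds[OF n] sets.sets_into_space[OF Eev] by auto
  then have "prob E = prob (\<Union>v\<in>{1..r n}. E \<inter> ?V v)" by (rule arg_cong)
  also have "\<dots> = (\<Sum>v\<in>{1..r n}. prob (E \<inter> ?V v))"
    using Eev Vev by (intro finite_measure_finite_Union) (auto simp: disjoint_family_on_def)
  finally have "(\<Sum>v\<in>{1..r n}. prob (E \<inter> ?V v)) \<noteq> 0" using pos by simp
  then obtain v where v: "v \<in> {1..r n}" "prob (E \<inter> ?V v) \<noteq> 0"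
    using sum.neutral[of "{1..r n}" "\<lambda>v. prob (E \<inter> ?V v)"] by blast
  then have Gpos: "0 < prob (G v)" using EV[OF v(1)] by (simp add: zero_less_measure_iff)
  have "prob (G v) / r n = prob (E \<inter> ?V v)" using EV[OF v(1)] by simp
  also have "\<dots> \<le> prob (E \<inter> G v)"
  proof (rule finite_measure_mono_AE)
    show "AE \<omega> in M. \<omega> \<in> E \<inter> ?V v \<longrightarrow> \<omega> \<in> E \<inter> G v"
      using EG[of v] by eventually_elim auto
  qed (use Eev Gev in auto)
  also have "\<dots> = prob E * prob (G v)" by (rule indep[OF G(1)])
  finally have "prob (G v) * (1 / r n) \<le> prob (G v) * prob E" by (simp add: mult.commute)
  then show ?thesis using Gpos by (simp only: mult_le_cancel_left_pos)
qed

end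

section \<open>Predicting a word from labels\<close>

text \<open>Labels are subsets of a finite set, so that a history of labels is their union. Each label is
  determined by the present and the past of the process and takes at most as many values as there
  are blocks.\<close>
locale labelled_split_word_process = finite_split_word_process +
  fixes n1 :: int and \<U> :: "'c set" and \<sigma> :: "int \<Rightarrow> 'a \<Rightarrow> 'c set" and L :: "int \<Rightarrow> 'c set set"
  assumes n1: "n1 \<le> 0" and finite_U: "finite \<U>"
    and \<sigma>_measurable: "\<And>k. k \<le> n1 \<Longrightarrow> \<sigma> k \<in> measurable (completed M (F k)) (count_space (Pow \<U>))"
    and \<sigma>_L: "\<And>k. k \<le> n1 \<Longrightarrow> AE \<omega> in M. \<sigma> k \<omega> \<in> L k"
    and L_subset: "\<And>k. k \<le> n1 \<Longrightarrow> L k \<subseteq> Pow \<U>"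
    and L_nonempty: "\<And>k. k \<le> n1 \<Longrightarrow> L k \<noteq> {}"
    and card_L: "\<And>k. k \<le> n1 \<Longrightarrow> card (L k) \<le> r k"
begin

definition T :: "int \<Rightarrow> int \<Rightarrow> 'a \<Rightarrow> 'c set" where "T n0 n \<omega> = (\<Union>k\<in>{n0<..n}. \<sigma> k \<omega>)"

lemma T_measurable:
  assumes "n0 \<le> n" "n \<le> n1"
  shows "T n0 n \<in> measurable (completed M (F n)) (count_space (Pow \<U>))"
  using assms
proof (induction n rule: int_ge_induct)
  case base
  have "T n0 n0 = (\<lambda>_. {})" by (auto simp: T_def)
  then show ?case by simp
next
  case (step n)
  have IH: "T n0 n \<in> measurable (completed M (F (n + 1))) (count_space (Pow \<U>))"
    using step completed_F_mono[of n "n + 1"] n1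
      measurable_mono[of "count_space (Pow \<U>)" "count_space (Pow \<U>)" "completed M (F n)" "completed M (F (n + 1))"]
    by auto
  have "{n0<..n + 1} = insert (n + 1) {n0<..n}" using step.hyps by auto
  then have "T n0 (n + 1) = (\<lambda>\<omega>. case_prod (\<union>) (T n0 n \<omega>, \<sigma> (n + 1) \<omega>))"
    by (simp add: T_def fun_eq_iff Un_commute)
  also have "\<dots> \<in> measurable (completed M (F (n + 1))) (count_space (Pow \<U>))"
    by (rule measurable_compose[OF measurable_Pair_count_space[OF IH \<sigma>_measurable]])
      (use step finite_U in auto)
  finally show ?case .
qed

abbreviation "cost' h \<equiv> cost (\<lambda>j. len (n1 - int j)) (\<lambda>j. r (n1 - int j)) (\<lambda>j. L (n1 - int j)) h"

text \<open>Given the past, \<open>V n\<close> is uniform, and the label that occurs is at best the optimal one. So the mean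
  cost can only grow with time.\<close>
lemma cost_descent:
  assumes n0: "n0 < n1 - int j"
  shows "expectation (\<lambda>\<omega>. cost' h (Suc j) (X (n1 - int (Suc j)) \<omega>) (T n0 (n1 - int (Suc j)) \<omega>)) \<le>
    expectation (\<lambda>\<omega>. cost' h j (X (n1 - int j) \<omega>) (T n0 (n1 - int j) \<omega>))"
proof -
  define n where "n = n1 - int j"
  have n: "n \<le> 0" "n \<le> n1" "n0 < n" "n1 - int (Suc j) = n - 1" using n1 n0 by (auto simp: n_def)
  let ?I = "words A (len (n - 1)) \<times> Pow \<U>"
  define Y where "Y \<omega> = (X (n - 1) \<omega>, T n0 (n - 1) \<omega>)" for \<omega>
  define g where "g v y = Min ((\<lambda>a. cost' h j (subword (len n) v (fst y)) (snd y \<union> a)) ` L n)" for v y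
  have finI: "finite ?I" using finite_words[OF finite_A] finite_U by simp
  have Y: "Y \<in> measurable (completed M (F (n - 1))) (count_space ?I)"
    unfolding Y_def using n finite_words[OF finite_A] finite_U
    by (intro measurable_Pair_count_space X_measurable_completed T_measurable) auto
  have YM: "Y \<in> measurable M (count_space ?I)"
    by (rule measurable_completedD[OF F_events Y]) (use n in simp)
  have XT: "(\<lambda>\<omega>. (X n \<omega>, T n0 n \<omega>)) \<in> measurable M (count_space (words A (len n) \<times> Pow \<U>))"
    using n finite_words[OF finite_A] finite_U
    by (intro measurable_Pair_count_space X_measurable measurable_completedD[OF F_events T_measurable]) auto
  have VY: "(\<lambda>\<omega>. (V n \<omega>, Y \<omega>)) \<in> measurable M (count_space ({1..r n} \<times> ?I))"
    by (intro measurable_Pair_count_space V_measurable n YM finI) simp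
  have "expectation (\<lambda>\<omega>. cost' h (Suc j) (X (n - 1) \<omega>) (T n0 (n - 1) \<omega>)) =
      expectation (\<lambda>\<omega>. (\<Sum>v<r n. g (v + 1) (Y \<omega>)) / r n)"
    by (simp add: g_def Y_def n_def[symmetric] subword_eq_block)
  also have "\<dots> = expectation (\<lambda>\<omega>. g (V n \<omega>) (Y \<omega>))"
    by (rule expectation_V[OF n(1) Y finI, symmetric])
  also have "\<dots> \<le> expectation (\<lambda>\<omega>. cost' h j (X n \<omega>) (T n0 n \<omega>))"
  proof (rule integral_mono_AE)
    show "integrable M (\<lambda>\<omega>. g (V n \<omega>) (Y \<omega>))"
      using integrable_finite_range[OF VY, of "case_prod g"] finI by simp
    show "integrable M (\<lambda>\<omega>. cost' h j (X n \<omega>) (T n0 n \<omega>))"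
      using integrable_finite_range[OF XT, of "case_prod (cost' h j)"] finite_words[OF finite_A] finite_U
      by simp
    have eq: "{n0<..n} = insert n {n0<..n - 1}" using n by auto
    have Tn: "T n0 n \<omega> = T n0 (n - 1) \<omega> \<union> \<sigma> n \<omega>" for \<omega>
      unfolding T_def eq by auto
    show "AE \<omega> in M. g (V n \<omega>) (Y \<omega>) \<le> cost' h j (X n \<omega>) (T n0 n \<omega>)"
      using X_split[OF n(1)] \<sigma>_L[OF n(2)]
    proof eventually_elim
      case (elim \<omega>)
      have "finite (L n)" using L_subset[OF n(2)] finite_U by (auto intro: finite_subset)
      then show ?case
        unfolding g_def Y_def Tn elim(1) fst_conv snd_conv using elim(2) by (intro Min_le) auto
    qed
  qed
  finally show ?thesis unfolding n(4) n_def[symmetric] .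
qed

lemma prediction_error:
  fixes s :: "nat \<Rightarrow> real"
  assumes s: "1 / len n1 \<le> s 0" "\<And>j. s j + log 2 (r (n1 - int j)) / len (n1 - int j) \<le> s (Suc j)"
    and s_half: "\<And>j. s j \<le> 1 / 2" and n0: "n0 \<le> n1"
  shows "1 / 2 \<le> prob {\<omega>\<in>space M. h (T n0 n1 \<omega>) \<noteq> X n1 \<omega>}"
proof -
  have descent: "expectation (\<lambda>\<omega>. cost' h j (X (n1 - int j) \<omega>) (T n0 (n1 - int j) \<omega>)) \<le>
      expectation (\<lambda>\<omega>. cost' h 0 (X (n1 - int 0) \<omega>) (T n0 (n1 - int 0) \<omega>))"
    if "n0 \<le> n1 - int j" for j
    using that
  proof (induction j)
    case (Suc j)
    have "expectation (\<lambda>\<omega>. cost' h (Suc j) (X (n1 - int (Suc j)) \<omega>) (T n0 (n1 - int (Suc j)) \<omega>)) \<le>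
      expectation (\<lambda>\<omega>. cost' h j (X (n1 - int j) \<omega>) (T n0 (n1 - int j) \<omega>))"
      by (rule cost_descent) (use Suc.prems in simp)
    also have "\<dots> \<le> expectation (\<lambda>\<omega>. cost' h 0 (X (n1 - int 0) \<omega>) (T n0 (n1 - int 0) \<omega>))"
      by (rule Suc.IH) (use Suc.prems in simp)
    finally show ?case .
  qed simp
  define J where "J = nat (n1 - n0)"
  have J: "n1 - int J = n0" using n0 by (simp add: J_def)
  have finL: "finite (L k)" if "k \<le> n1" for k
    using L_subset[OF that] finite_U by (auto intro: finite_subset)
  have len: "len (n1 - int (Suc j)) = r (n1 - int j) * len (n1 - int j)" for j
    using len_ratio[of "n1 - int j"] n1 by (simp add: algebra_simps)
  have "1 / 2 \<le> (\<Sum>x\<in>words A (len (n1 - int J)). cost' h J x {}) / card A ^ len (n1 - int J)"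
    by (rule cost_mean[OF finite_A card_A _ _ _ _ _ _ _ s_half])
      (use n1 s len len_pos finL L_nonempty card_L in auto)
  also have "\<dots> = expectation (\<lambda>\<omega>. cost' h J (X (n1 - int J) \<omega>) {})"
    by (rule X_expectation[symmetric]) (use n1 in simp)
  also have "\<dots> = expectation (\<lambda>\<omega>. cost' h J (X (n1 - int J) \<omega>) (T n0 (n1 - int J) \<omega>))"
    by (simp add: J T_def)
  also have "\<dots> \<le> expectation (\<lambda>\<omega>. cost' h 0 (X n1 \<omega>) (T n0 n1 \<omega>))"
    using descent[of J] J by simp
  also have "\<dots> = prob {\<omega>\<in>space M. h (T n0 n1 \<omega>) \<noteq> X n1 \<omega>}"
  proof -
    have XT: "(\<lambda>\<omega>. (X n1 \<omega>, T n0 n1 \<omega>)) \<in> measurable M (count_space (words A (len n1) \<times> Pow \<U>))"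
      using n0 n1 finite_words[OF finite_A] finite_U
      by (intro measurable_Pair_count_space X_measurable measurable_completedD[OF F_events T_measurable]) auto
    let ?B = "{\<omega>\<in>space M. h (T n0 n1 \<omega>) \<noteq> X n1 \<omega>}"
    have "?B = (\<lambda>\<omega>. (X n1 \<omega>, T n0 n1 \<omega>)) -` {(x, w) \<in> words A (len n1) \<times> Pow \<U>. h w \<noteq> x} \<inter> space M"
      using measurable_space[OF XT] by auto
    then have "?B \<in> events"
      using measurable_sets[OF XT, of "{(x, w) \<in> words A (len n1) \<times> Pow \<U>. h w \<noteq> x}"] by auto
    moreover have "expectation (\<lambda>\<omega>. cost' h 0 (X n1 \<omega>) (T n0 n1 \<omega>)) = expectation (indicator ?B)"
      by (rule Bochner_Integration.integral_cong) (auto simp: indicator_def)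
    ultimately show ?thesis by simp
  qed
  finally show ?thesis .
qed

end

section \<open>Filtrations of product type\<close>
definition determined_by :: "'w set \<Rightarrow> 'w set set \<Rightarrow> 'w set \<Rightarrow> bool" where
  "determined_by \<Omega> \<C> E \<longleftrightarrow>
     (\<forall>\<omega>\<in>\<Omega>. \<forall>\<omega>'\<in>\<Omega>. (\<forall>C\<in>\<C>. \<omega> \<in> C \<longleftrightarrow> \<omega>' \<in> C) \<longrightarrow> (\<omega> \<in> E \<longleftrightarrow> \<omega>' \<in> E))"

text \<open>Events that depend on finitely many generators are dense in the generated \<open>\<sigma>\<close>-field.\<close>
lemma (in prob_space) finitely_determined_approx:
  assumes \<A>: "\<A> \<subseteq> events" and E: "E \<in> sigma_sets (space M) \<A>" and \<epsilon>: "0 < \<epsilon>"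
  shows "\<exists>\<C> D. finite \<C> \<and> \<C> \<subseteq> \<A> \<and> D \<in> events \<and> determined_by (space M) \<C> D \<and> prob (sym_diff E D) < \<epsilon>"
  using E \<epsilon>
proof (induction arbitrary: \<epsilon>)
  case (Basic E)
  show ?case
    by (rule exI[of _ "{E}"], rule exI[of _ E]) (use Basic \<A> in \<open>auto simp: determined_by_def\<close>)
next
  case Empty
  show ?case
    by (rule exI[of _ "{}"], rule exI[of _ "{}"]) (use Empty in \<open>auto simp: determined_by_def\<close>)
next
  case (Compl E)
  obtain \<C> D where D: "finite \<C>" "\<C> \<subseteq> \<A>" "D \<in> events" "determined_by (space M) \<C> D"
      "prob (sym_diff E D) < \<epsilon>"
    using Compl.IH[OF Compl.prems] by blast
  have "E \<subseteq> space M"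
    by (rule sets.sets_into_space[OF subsetD[OF sets.sigma_sets_subset[OF \<A>] Compl.hyps]])
  then have "sym_diff (space M - E) (space M - D) = sym_diff E D"
    using sets.sets_into_space[OF D(3)] by auto
  then have "prob (sym_diff (space M - E) (space M - D)) < \<epsilon>" using D(5) by (simp only:)
  moreover have "determined_by (space M) \<C> (space M - D)"
    using D(4) unfolding determined_by_def by blast
  ultimately show ?case
    using D(1,2) sets.compl_sets[OF D(3)] by blast
next
  case (Union E)
  have Ev: "E i \<in> events" for i
    using Union.hyps sets.sigma_sets_subset[OF \<A>] by blast
  have "incseq (\<lambda>n. \<Union>i<n. E i)"
    unfolding incseq_def by (intro allI impI UN_mono) auto
  then have "(\<lambda>n. prob (\<Union>i<n. E i)) \<longlonglongrightarrow> prob (\<Union>n. \<Union>i<n. E i)"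
    using Ev by (intro finite_Lim_measure_incseq) auto
  moreover have "(\<Union>n. \<Union>i<n. E i) = (\<Union>i. E i)" by blast
  ultimately have "eventually (\<lambda>n. prob (\<Union>i. E i) - \<epsilon> / 2 < prob (\<Union>i<n. E i)) sequentially"
    using Union.prems by (intro order_tendstoD(1)) auto
  then obtain n where n: "prob (\<Union>i. E i) - \<epsilon> / 2 < prob (\<Union>i<n. E i)"
    unfolding eventually_sequentially by blast
  have U: "(\<Union>i. E i) \<in> events" "(\<Union>i<n. E i) \<in> events" using Ev by auto
  have "prob ((\<Union>i. E i) - (\<Union>i<n. E i)) = prob (\<Union>i. E i) - prob (\<Union>i<n. E i)"
    by (rule finite_measure_Diff[OF U]) blast
  then have tail: "prob ((\<Union>i. E i) - (\<Union>i<n. E i)) < \<epsilon> / 2" using n by simp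
  define \<delta> where "\<delta> = \<epsilon> / (2 * real (Suc n))"
  have \<delta>: "0 < \<delta>" using Union.prems by (simp add: \<delta>_def)
  have "\<forall>i. \<exists>\<C> D. finite \<C> \<and> \<C> \<subseteq> \<A> \<and> D \<in> events \<and> determined_by (space M) \<C> D \<and>
      prob (sym_diff (E i) D) < \<delta>"
    using Union.IH[OF \<delta>] by blast
  from this[unfolded choice_iff] obtain \<C> D where D: "\<And>i. finite (\<C> i)" "\<And>i. \<C> i \<subseteq> \<A>" "\<And>i. D i \<in> events"
      "\<And>i. determined_by (space M) (\<C> i) (D i)" "\<And>i. prob (sym_diff (E i) (D i)) < \<delta>"
    by blast
  have sd: "sym_diff (E i) (D i) \<in> events" for i using Ev D(3) by auto
  have "prob (sym_diff (\<Union>i. E i) (\<Union>i<n. D i)) \<le>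
      prob (((\<Union>i. E i) - (\<Union>i<n. E i)) \<union> (\<Union>i<n. sym_diff (E i) (D i)))"
    using Ev sd by (intro finite_measure_mono sets.Un sets.Diff sets.countable_UN' sets.finite_UN) auto
  also have "\<dots> \<le> prob ((\<Union>i. E i) - (\<Union>i<n. E i)) + prob (\<Union>i<n. sym_diff (E i) (D i))"
    using Ev sd by (intro measure_Un_le sets.Diff sets.countable_UN' sets.finite_UN) auto
  also have "prob (\<Union>i<n. sym_diff (E i) (D i)) \<le> (\<Sum>i<n. prob (sym_diff (E i) (D i)))"
    using sd by (intro finite_measure_subadditive_finite) auto
  also have "\<dots> \<le> (\<Sum>i<n. \<delta>)"
    using D(5) by (intro sum_mono less_imp_le)
  also have "\<dots> \<le> \<epsilon> / 2"
    using Union.prems by (simp add: \<delta>_def field_simps)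
  finally have "prob (sym_diff (\<Union>i. E i) (\<Union>i<n. D i)) < \<epsilon>" using tail by simp
  moreover have "determined_by (space M) (\<Union>i<n. \<C> i) (\<Union>i<n. D i)"
    unfolding determined_by_def
  proof (intro ballI impI)
    fix \<omega> \<omega>'
    assume \<omega>: "\<omega> \<in> space M" "\<omega>' \<in> space M"
      and agree: "\<forall>C\<in>\<Union>i<n. \<C> i. \<omega> \<in> C \<longleftrightarrow> \<omega>' \<in> C"
    have "\<omega> \<in> D i \<longleftrightarrow> \<omega>' \<in> D i" if "i < n" for i
    proof -
      have "\<forall>C\<in>\<C> i. \<omega> \<in> C \<longleftrightarrow> \<omega>' \<in> C" using agree that by blast
      then show ?thesis using D(4)[of i] \<omega> unfolding determined_by_def by blast
    qed
    then show "\<omega> \<in> (\<Union>i<n. D i) \<longleftrightarrow> \<omega>' \<in> (\<Union>i<n. D i)" by blast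
  qed
  moreover have "finite (\<Union>i<n. \<C> i)" "(\<Union>i<n. \<C> i) \<subseteq> \<A>" "(\<Union>i<n. D i) \<in> events"
    using D(1-3) by auto
  ultimately show ?case by blast
qed

locale product_split_word_process = finite_split_word_process M A len X V
  for M :: "'w measure" and A :: "'a set" and len X V +
  fixes S :: "int \<Rightarrow> 'w measure" and W :: "int \<Rightarrow> 'w \<Rightarrow> 'w"
  assumes indep_W: "indep_vars S W {..0}"
    and gen_W: "\<And>n. n \<le> 0 \<Longrightarrow> eq_mod_null M (F n) (natural_filtration M S W n)"
begin

definition \<W> :: "int \<Rightarrow> 'w set set" where "\<W> k = {W k -` B \<inter> space M | B. B \<in> sets (S k)}"

abbreviation "\<H> \<equiv> natural_filtration M S W"

lemma W_measurable: "k \<le> 0 \<Longrightarrow> W k \<in> measurable M (S k)"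
  using indep_W by (simp add: indep_vars_def2)

lemma \<W>_events: "k \<le> 0 \<Longrightarrow> \<W> k \<subseteq> events"
  using W_measurable by (auto simp: \<W>_def)

lemma \<W>_sigma_algebra:
  assumes "k \<le> 0"
  shows "sigma_algebra (space M) (\<W> k)"
proof -
  have "W k \<in> space M \<rightarrow> space (S k)" using measurable_space[OF W_measurable[OF assms]] by auto
  from sets_vimage_algebra2[OF this] have "\<W> k = sets (vimage_algebra (space M) (W k) (S k))"
    by (simp add: \<W>_def)
  then show ?thesis
    using sets.sigma_algebra_axioms[of "vimage_algebra (space M) (W k) (S k)"] by simp
qed

lemma \<H>_sigma_sets: "\<H> n = sigma_sets (space M) (\<Union>k\<in>{..n}. \<W> k)"
  by (simp add: natural_filtration_def sigma_field_of_def \<W>_def)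

lemma \<H>_events: "n \<le> 0 \<Longrightarrow> \<H> n \<subseteq> events"
  unfolding natural_filtration_def by (rule sigma_field_of_subset) (auto intro: W_measurable)

lemma completed_\<H>: "n \<le> 0 \<Longrightarrow> sets (completed M (\<H> n)) = sets (completed M (F n))"
  using gen_W[of n] eq_mod_null_iff_completed[OF F_events \<H>_events, of n n] by simp

lemma \<W>_completed_F: "k \<le> n \<Longrightarrow> n \<le> 0 \<Longrightarrow> C \<in> \<W> k \<Longrightarrow> C \<in> sets (completed M (F n))"
  using completedI(1)[OF \<H>_events, of n C] completed_\<H>[of n]
  by (auto simp: \<H>_sigma_sets intro: sigma_sets.Basic)

lemma \<W>_indep_past:
  assumes k: "k \<le> 0" and C: "C \<in> \<W> k" and G: "G \<in> F (k - 1)"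
  shows "prob (C \<inter> G) = prob C * prob G"
proof -
  have past: "prob (C \<inter> G) = prob C * prob G" if G: "G \<in> \<H> (k - 1)" for G
  proof -
    define I where "I b = (if b then {k} else {..k - 1})" for b
    have "indep_sets (\<lambda>b. sigma_sets (space M) (\<Union>i\<in>I b. \<W> i)) UNIV"
    proof (rule indep_sets_collect_sigma)
      have "indep_sets \<W> {..0}"
        using indep_W unfolding indep_vars_def2 \<W>_def by simp
      then show "indep_sets \<W> (\<Union>b\<in>UNIV. I b)"
        by (rule indep_sets_mono_index[rotated]) (use k in \<open>auto simp: I_def split: if_splits\<close>)
      fix b i assume "i \<in> I b"
      then interpret sigma_algebra "space M" "\<W> i"
        by (intro \<W>_sigma_algebra) (use k in \<open>auto simp: I_def split: if_splits\<close>)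
      show "Int_stable (\<W> i)" by (auto simp: Int_stable_def)
    qed (auto simp: disjoint_family_on_def I_def split: if_splits)
    moreover have "C \<in> sigma_sets (space M) (\<Union>i\<in>I True. \<W> i)"
      "G \<in> sigma_sets (space M) (\<Union>i\<in>I False. \<W> i)"
      using C G by (auto simp: I_def \<H>_sigma_sets)
    ultimately have "prob (\<Inter>b\<in>{True, False}. if b then C else G) =
        (\<Prod>b\<in>{True, False}. prob (if b then C else G))"
      by (intro indep_setsD[where I = UNIV]) auto
    then show ?thesis by (simp add: Int_commute)
  qed
  have "G \<in> sets (completed M (\<H> (k - 1)))"
    using completed_\<H>[of "k - 1"] completedI(1)[OF F_events, of "k - 1" G] k G by auto
  moreover have "sigma_algebra (space M) (\<H> (k - 1))"
    unfolding natural_filtration_def by (rule sigma_algebra_sigma_field_of)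
  ultimately show ?thesis
    using prob_completed[OF _ \<H>_events _ past] \<W>_events[OF k] C k by auto
qed

text \<open>The labels to which \<open>prediction_error\<close> is applied: the events of \<open>\<C>\<close> that depend on \<open>W k\<close> only
  and that occur.\<close>
definition signature :: "'w set set \<Rightarrow> int \<Rightarrow> 'w \<Rightarrow> 'w set set" where
  "signature \<C> k \<omega> = {C\<in>\<C> \<inter> \<W> k. \<omega> \<in> C}"

definition labels :: "'w set set \<Rightarrow> int \<Rightarrow> 'w set set set" where
  "labels \<C> k = {a\<in>Pow \<C>. 0 < prob (signature \<C> k -` {a} \<inter> space M)}"

lemma signature_event:
  assumes k: "k \<le> 0" and fin: "finite \<C>"
  shows "signature \<C> k -` {a} \<inter> space M \<in> \<W> k"
proof -
  interpret sigma_algebra "space M" "\<W> k" by (rule \<W>_sigma_algebra[OF k])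
  show ?thesis
  proof (cases "a \<subseteq> \<C> \<inter> \<W> k")
    case True
    have "signature \<C> k -` {a} \<inter> space M = {\<omega>\<in>space M. \<forall>C\<in>\<C> \<inter> \<W> k. \<omega> \<in> C \<longleftrightarrow> C \<in> a}"
    proof -
      have "signature \<C> k \<omega> = a \<longleftrightarrow> (\<forall>C\<in>\<C> \<inter> \<W> k. \<omega> \<in> C \<longleftrightarrow> C \<in> a)" for \<omega>
        using True unfolding signature_def by blast
      then show ?thesis by blast
    qed
    also have "\<dots> \<in> \<W> k"
    proof (rule sets_Collect_finite_All)
      fix C assume C: "C \<in> \<C> \<inter> \<W> k"
      then have "C \<subseteq> space M" using sets_into_space by blast
      then have "{\<omega>\<in>space M. \<omega> \<in> C \<longleftrightarrow> C \<in> a} = (if C \<in> a then C else space M - C)"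
        by auto
      then show "{\<omega>\<in>space M. \<omega> \<in> C \<longleftrightarrow> C \<in> a} \<in> \<W> k" using C by auto
    qed (use fin in auto)
    finally show ?thesis .
  next
    case False
    then have "signature \<C> k -` {a} \<inter> space M = {}" unfolding signature_def by blast
    then show ?thesis by simp
  qed
qed

text \<open>The values of positive probability are disjoint events of probability at least \<open>1 / r k\<close> each, by
  \<open>innovation_atom\<close>.\<close>
lemma labels_signature:
  assumes k: "k \<le> 0" and fin: "finite \<C>"
  shows "signature \<C> k \<in> measurable (completed M (F k)) (count_space (Pow \<C>))"
    and "AE \<omega> in M. signature \<C> k \<omega> \<in> labels \<C> k"
    and "labels \<C> k \<noteq> {}"
    and "card (labels \<C> k) \<le> r k"
proof -
  let ?E = "\<lambda>a. signature \<C> k -` {a} \<inter> space M"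
  have ev: "?E a \<in> \<W> k" for a by (rule signature_event[OF k fin])
  have ev': "?E a \<in> events" for a using ev \<W>_events[OF k] by auto
  have Pow: "signature \<C> k \<omega> \<in> Pow \<C>" for \<omega> by (auto simp: signature_def)
  show "signature \<C> k \<in> measurable (completed M (F k)) (count_space (Pow \<C>))"
    unfolding measurable_count_space_eq2[OF finite_Pow_iff[THEN iffD2, OF fin]]
    using Pow \<W>_completed_F[OF order_refl k ev] by auto
  have "AE \<omega> in M. \<forall>a\<in>Pow \<C> - labels \<C> k. \<omega> \<notin> ?E a"
  proof (rule AE_finite_allI)
    fix a assume "a \<in> Pow \<C> - labels \<C> k"
    then have "prob (?E a) = 0" by (simp add: labels_def zero_less_measure_iff)
    then have "?E a \<in> null_sets M" using ev' by (simp add: null_sets_def emeasure_eq_measure)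
    then show "AE \<omega> in M. \<omega> \<notin> ?E a" by (rule AE_not_in)
  qed (use fin in simp)
  then show AE: "AE \<omega> in M. signature \<C> k \<omega> \<in> labels \<C> k"
    using AE_space by eventually_elim (use Pow in auto)
  show "labels \<C> k \<noteq> {}"
    using AE by (auto dest: AE_E2 simp: prob_space)
  have "card (labels \<C> k) * (1 / r k) \<le> (\<Sum>a\<in>labels \<C> k. prob (?E a))"
  proof (rule sum_bounded_below)
    fix a assume "a \<in> labels \<C> k"
    then show "1 / r k \<le> prob (?E a)"
      by (intro innovation_atom[OF k] \<W>_completed_F[OF order_refl k ev] \<W>_indep_past[OF k ev])
        (auto simp: labels_def)
  qed
  also have "\<dots> = prob (\<Union>a\<in>labels \<C> k. ?E a)"
    using fin ev' by (intro finite_measure_finite_Union[symmetric])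
      (auto simp: labels_def disjoint_family_on_def)
  also have "\<dots> \<le> 1" by (rule prob_le_1)
  finally show "card (labels \<C> k) \<le> r k"
    using ratio_ge_2[OF k] by (simp add: divide_le_eq)
qed

text \<open>For each word \<open>x\<close>, the event that \<open>X n = x\<close> is approximated by an event determined by a finite
  family. Outside the union of the errors, the occurring events of all these families single out
  the value of \<open>X n\<close>.\<close>
lemma X_predictable:
  assumes n: "n \<le> 0"
  shows "\<exists>\<C> n0 h. finite \<C> \<and> n0 \<le> n \<and>
    prob {\<omega>\<in>space M. h (\<Union>k\<in>{n0<..n}. signature \<C> k \<omega>) \<noteq> X n \<omega>} < 1 / 2"
proof -
  let ?I = "words A (len n)" let ?E = "\<lambda>x. X n -` {x} \<inter> space M"
  have finI: "finite ?I" by (rule finite_words[OF finite_A])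
  have cI: "0 < card ?I" using finI words_nonempty[OF A_nonempty, of "len n"] by (simp add: card_gt_0_iff)
  define \<epsilon> where "\<epsilon> = 1 / (4 * real (card ?I))"
  have \<epsilon>: "0 < \<epsilon>" using cI by (simp add: \<epsilon>_def)
  have "\<exists>\<C> D. finite \<C> \<and> \<C> \<subseteq> (\<Union>k\<in>{..n}. \<W> k) \<and> D \<in> events \<and> determined_by (space M) \<C> D \<and>
      prob (sym_diff (?E x) D) < \<epsilon>" if x: "x \<in> ?I" for x
  proof -
    have "?E x \<in> sets (completed M (\<H> n))"
      using measurable_sets[OF X_measurable_completed[OF order_refl n], of "{x}"] x
      unfolding completed_\<H>[OF n] by simp
    moreover have "sigma_algebra (space M) (\<H> n)"
      unfolding natural_filtration_def by (rule sigma_algebra_sigma_field_of)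
    ultimately obtain H where H: "H \<in> \<H> n" "AE \<omega> in M. \<omega> \<in> ?E x \<longleftrightarrow> \<omega> \<in> H"
      using completed_approx[OF _ \<H>_events[OF n]] by blast
    have \<A>: "(\<Union>k\<in>{..n}. \<W> k) \<subseteq> events"
      by (rule UN_least, rule \<W>_events) (use n in simp)
    obtain \<C> D where D: "finite \<C>" "\<C> \<subseteq> (\<Union>k\<in>{..n}. \<W> k)" "D \<in> events"
        "determined_by (space M) \<C> D" "prob (sym_diff H D) < \<epsilon>"
      using finitely_determined_approx[OF \<A> H(1)[unfolded \<H>_sigma_sets] \<epsilon>] by blast
    have "?E x \<in> events" using measurable_sets[OF X_measurable[OF n], of "{x}"] x by simp
    moreover have "H \<in> events" using H(1) \<H>_events[OF n] by auto
    moreover have "AE \<omega> in M. \<omega> \<in> sym_diff (?E x) D \<longleftrightarrow> \<omega> \<in> sym_diff H D"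
      using H(2) by eventually_elim auto
    ultimately have "prob (sym_diff (?E x) D) = prob (sym_diff H D)"
      using D(3) by (intro finite_measure_eq_AE) auto
    then show ?thesis using D by (intro exI[of _ \<C>] exI[of _ D]) simp
  qed
  then have "\<forall>x\<in>?I. \<exists>p. finite (fst p) \<and> fst p \<subseteq> (\<Union>k\<in>{..n}. \<W> k) \<and> snd p \<in> events \<and>
      determined_by (space M) (fst p) (snd p) \<and> prob (sym_diff (?E x) (snd p)) < \<epsilon>"
    by (metis fst_conv snd_conv)
  from bchoice[OF this] obtain p where p: "\<And>x. x \<in> ?I \<Longrightarrow> finite (fst (p x))"
      "\<And>x. x \<in> ?I \<Longrightarrow> fst (p x) \<subseteq> (\<Union>k\<in>{..n}. \<W> k)" "\<And>x. x \<in> ?I \<Longrightarrow> snd (p x) \<in> events"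
      "\<And>x. x \<in> ?I \<Longrightarrow> determined_by (space M) (fst (p x)) (snd (p x))"
      "\<And>x. x \<in> ?I \<Longrightarrow> prob (sym_diff (?E x) (snd (p x))) < \<epsilon>" by blast
  define \<C> where "\<C> = (\<Union>x\<in>?I. fst (p x))"
  have fin: "finite \<C>" unfolding \<C>_def using finI p(1) by blast
  have "\<forall>C\<in>\<C>. \<exists>k\<le>n. C \<in> \<W> k" using p(2) unfolding \<C>_def by blast
  then obtain \<kappa> where \<kappa>: "\<And>C. C \<in> \<C> \<Longrightarrow> \<kappa> C \<le> n \<and> C \<in> \<W> (\<kappa> C)" by metis
  define n0 where "n0 = Min (insert n (\<kappa> ` \<C>)) - 1"
  have lower: "n0 < i" if "i \<in> insert n (\<kappa> ` \<C>)" for i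
    using Min_le[OF _ that] fin by (simp add: n0_def)
  have n0: "n0 < n" "\<And>C. C \<in> \<C> \<Longrightarrow> n0 < \<kappa> C"
    by (rule lower, simp)+
  define T where "T \<omega> = (\<Union>k\<in>{n0<..n}. signature \<C> k \<omega>)" for \<omega>
  have T: "T \<omega> = {C\<in>\<C>. \<omega> \<in> C}" for \<omega>
  proof
    show "T \<omega> \<subseteq> {C\<in>\<C>. \<omega> \<in> C}" unfolding T_def signature_def by blast
    show "{C\<in>\<C>. \<omega> \<in> C} \<subseteq> T \<omega>"
    proof
      fix C assume "C \<in> {C\<in>\<C>. \<omega> \<in> C}"
      then have "\<kappa> C \<in> {n0<..n}" "C \<in> signature \<C> (\<kappa> C) \<omega>"
        using \<kappa>[of C] n0(2)[of C] by (auto simp: signature_def)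
      then show "C \<in> T \<omega>" unfolding T_def by blast
    qed
  qed
  \<comment> \<open>The value of \<open>h\<close> at a pattern \<open>w\<close> is only meaningful if \<open>w\<close> occurs outside the exceptional set.\<close>
  define h where "h w = (SOME x. x \<in> ?I \<and> (\<exists>\<omega>\<in>space M. T \<omega> = w \<and> \<omega> \<in> snd (p x)))" for w
  let ?B = "\<Union>x\<in>?I. sym_diff (?E x) (snd (p x))"
  have Ev: "sym_diff (?E x) (snd (p x)) \<in> events" if "x \<in> ?I" for x
    using measurable_sets[OF X_measurable[OF n], of "{x}"] p(3)[OF that] that by auto
  have "h (T \<omega>) = X n \<omega>" if \<omega>: "\<omega> \<in> space M" "\<omega> \<notin> ?B" for \<omega>
  proof -
    have good: "\<omega> \<in> snd (p x) \<longleftrightarrow> X n \<omega> = x" if x: "x \<in> ?I" for x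
    proof -
      have "\<omega> \<notin> sym_diff (?E x) (snd (p x))" using \<omega>(2) x by blast
      then show ?thesis using \<omega>(1) by blast
    qed
    have XI: "X n \<omega> \<in> ?I" by (rule X_words[OF n \<omega>(1)])
    have uniq: "x = X n \<omega>"
      if x: "x \<in> ?I" and \<omega>': "\<omega>' \<in> space M" "T \<omega>' = T \<omega>" "\<omega>' \<in> snd (p x)" for x \<omega>'
    proof -
      have "\<omega>' \<in> C \<longleftrightarrow> \<omega> \<in> C" if "C \<in> fst (p x)" for C
      proof -
        have "C \<in> \<C>" using that x unfolding \<C>_def by blast
        then show ?thesis using \<omega>'(2) unfolding T by blast
      qed
      then have "\<forall>C\<in>fst (p x). \<omega>' \<in> C \<longleftrightarrow> \<omega> \<in> C" by blast
      then have "\<omega>' \<in> snd (p x) \<longleftrightarrow> \<omega> \<in> snd (p x)"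
        by (rule mp[OF bspec[OF bspec[OF p(4)[OF x, unfolded determined_by_def] \<omega>'(1)] \<omega>(1)]])
      then show ?thesis using good[OF x] \<omega>'(3) by simp
    qed
    show ?thesis
      unfolding h_def
    proof (rule some_equality)
      show "X n \<omega> \<in> ?I \<and> (\<exists>\<omega>'\<in>space M. T \<omega>' = T \<omega> \<and> \<omega>' \<in> snd (p (X n \<omega>)))"
        using XI good[OF XI] \<omega>(1) by blast
    next
      fix x assume "x \<in> ?I \<and> (\<exists>\<omega>'\<in>space M. T \<omega>' = T \<omega> \<and> \<omega>' \<in> snd (p x))"
      then show "x = X n \<omega>" using uniq by blast
    qed
  qed
  then have "{\<omega>\<in>space M. h (T \<omega>) \<noteq> X n \<omega>} \<subseteq> ?B" by blast
  then have "prob {\<omega>\<in>space M. h (T \<omega>) \<noteq> X n \<omega>} \<le> prob ?B"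
    using Ev finI by (intro finite_measure_mono sets.finite_UN) auto
  also have "\<dots> \<le> (\<Sum>x\<in>?I. prob (sym_diff (?E x) (snd (p x))))"
    using Ev finI by (intro finite_measure_subadditive_finite) auto
  also have "\<dots> \<le> (\<Sum>x\<in>?I. \<epsilon>)" using p(5) by (intro sum_mono less_imp_le)
  also have "\<dots> < 1 / 2" using cI by (simp add: \<epsilon>_def)
  finally show ?thesis
    using fin n0(1) unfolding T_def by (intro exI[of _ \<C>] exI[of _ n0] exI[of _ h]) simp
qed

lemma small_ratio_sums_contradiction:
  fixes s :: "nat \<Rightarrow> real"
  assumes n: "n \<le> 0" and s: "1 / len n \<le> s 0"
    "\<And>j. s j + log 2 (r (n - int j)) / len (n - int j) \<le> s (Suc j)" and s_half: "\<And>j. s j \<le> 1 / 2"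
  shows False
proof -
  obtain \<C> n0 h where \<C>: "finite \<C>" "n0 \<le> n"
      "prob {\<omega>\<in>space M. h (\<Union>k\<in>{n0<..n}. signature \<C> k \<omega>) \<noteq> X n \<omega>} < 1 / 2"
    using X_predictable[OF n] by blast
  interpret labelled_split_word_process M A len X V n \<C> "signature \<C>" "labels \<C>"
    by unfold_locales (use n \<C>(1) labels_signature[OF _ \<C>(1)] in \<open>auto simp: labels_def[of \<C>]\<close>)
  show False
    using prediction_error[OF s s_half \<C>(2), of h] \<C>(3) by (simp add: T_def)
qed

end

context tower_split_word_process
begin

text \<open>Time \<open>-3\<close> is early enough: there \<open>len = 256\<close>, and the remaining sum of
  \<open>log 2 (r k) / len k\<close> is at most \<open>1 / 4\<close>.\<close>
lemma ratio_bound: "log 2 (r (- 3 - int j)) / len (- 3 - int j) \<le> (1 / 2) ^ (3 + j)"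
proof -
  define e where "e = tower (3 + j)"
  have "4 + j \<le> e"
    unfolding e_def
  proof (induction j)
    case 0
    show ?case by (simp add: eval_nat_numeral)
  next
    case (Suc j)
    have "tower (3 + j) < tower (3 + Suc j)"
      using less_exp[of "tower (3 + j)"] by (simp only: add_Suc_right tower.simps(2))
    then show ?case using Suc by simp
  qed
  have l: "len (- 3 - int j) = 4 ^ e" using len_tower[of "3 + j"] by (simp add: e_def)
  have l': "len (- 3 - int j - 1) = 4 ^ (2 ^ e)"
  proof -
    have "- 3 - int j - 1 = - int (Suc (3 + j))" by simp
    then show ?thesis using len_tower[of "Suc (3 + j)"] by (simp only: tower.simps(2) e_def)
  qed
  have "0 < r (- 3 - int j)" using ratio_ge_2[of "- 3 - int j"] by simp
  moreover have "real (r (- 3 - int j)) \<le> 4 ^ (2 ^ e)"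
    unfolding split_ratio_def l' by (rule order_trans[OF of_nat_mono[OF div_le_dividend]]) simp
  ultimately have "log 2 (r (- 3 - int j)) \<le> log 2 (4 ^ (2 ^ e))" by simp
  also have "\<dots> = 2 ^ e * log 2 (2 ^ 2)" by (simp add: log_nat_power)
  also have "\<dots> = 2 * 2 ^ e" by (simp only: log_pow_cancel)
  finally have "log 2 (r (- 3 - int j)) / len (- 3 - int j) \<le> 2 * 2 ^ e / 4 ^ e"
    unfolding l by (simp add: divide_right_mono)
  also have "(4::real) ^ e = 2 ^ e * 2 ^ e" by (simp add: power_mult_distrib[symmetric])
  also have "2 * 2 ^ e / (2 ^ e * 2 ^ e) = 2 * (1 / 2 :: real) ^ e" by (simp add: power_divide)
  also have "\<dots> \<le> 2 * (1 / 2) ^ (4 + j)"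
    using \<open>4 + j \<le> e\<close> by (intro mult_left_mono power_decreasing) auto
  also have "\<dots> = (1 / 2) ^ (3 + j)" by (simp add: power_add power_divide)
  finally show ?thesis .
qed

lemma not_product_type: "\<not> product_type M F"
proof
  assume "product_type M F"
  then obtain S :: "int \<Rightarrow> 'a measure" and W :: "int \<Rightarrow> 'a \<Rightarrow> 'a" where SW: "indep_vars S W {..0}"
      "\<And>n. n \<le> 0 \<Longrightarrow> eq_mod_null M (F n) (natural_filtration M S W n)"
    unfolding product_type_def by blast
  interpret product_split_word_process M A len X V S W
    by unfold_locales (use SW in auto)
  \<comment> \<open>The partial sums: \<open>1 / 256 \<le> 1 / 4\<close>, and the \<open>j\<close>-th term is at most \<open>(1 / 2) ^ (3 + j)\<close>.\<close>
  define s :: "nat \<Rightarrow> real" where "s j = 1 / 2 - (1 / 2) ^ (2 + j)" for j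
  have "len (- 3) = 256" using len_tower[of 3] by (simp add: eval_nat_numeral)
  then have "1 / len (- 3) \<le> s 0" by (simp add: s_def power2_eq_square)
  moreover have "s j + log 2 (r (- 3 - int j)) / len (- 3 - int j) \<le> s (Suc j)" for j
    using ratio_bound[of j] by (simp add: s_def power_add power_divide)
  moreover have "s j \<le> 1 / 2" for j by (simp add: s_def)
  ultimately show False using small_ratio_sums_contradiction[of "- 3" s] by simp
qed

end

theorem mainTheorem2:
  fixes M :: "'w measure" and A :: "'a set" and N :: nat and len :: "int \<Rightarrow> nat"
    and X :: "int \<Rightarrow> 'w \<Rightarrow> 'a list" and V :: "int \<Rightarrow> 'w \<Rightarrow> nat"
  assumes "finite A" and "card A = N" and "N \<ge> 2"
    and "len 0 = 1"
    and "\<And>n. n \<le> 0 \<Longrightarrow> real (len (n - 1)) = 4 powr sqrt (real (len n))"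
    and "split_word_process M A len X V"
  shows "\<not> product_type M (split_word_filtration M A len X V) \<and>
    (\<forall>\<phi> :: int \<Rightarrow> int.
       \<phi> ` {..0} \<subseteq> {..0} \<longrightarrow> strict_mono_on {..0} \<phi> \<longrightarrow>
       filterlim (\<lambda>n. \<phi> n - n) at_bot at_bot \<longrightarrow>
       product_type M (\<lambda>n. split_word_filtration M A len X V (\<phi> n)))"
proof -
  interpret split_word_process M A len X V by fact
  interpret tower_split_word_process M A len X V
    by unfold_locales (use assms(1-3) len_eq_tower[OF assms(4,5)] in auto)
  show ?thesis
    by (intro conjI allI impI not_product_type product_type_jumping)
qed

end
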